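(* Let $D=[\underline x,\overline x]\subset\mathbb R^d$ be a nondegenerate rectangle and let $P,Q$ be Borel probability measures with supports contained in $D$. At $\gamma=0$, lower-orthant CSD of $Q$ over $P$ coincides with multivariate FOSD of $Q$ over $P$, and at $\gamma=1$ it coincides with second-degree lower-orthant dominance of $Q$ over $P$. When $d=1$, lower-orthant CSD coincides, for every $\gamma\in[0,1]$, with $(1+\gamma)$-stochastic dominance of $Q$ over $P$.
   Context: All vector inequalities are coordinatewise; $t_+:=\max\{t,0\}$; $\mathcal C(P,Q)$ is the set of couplings of $P$ and $Q$ (first marginal $P$, second marginal $Q$). $F_R(t):=R\{x:x\le t\}$ is the distribution function of a probability law $R$ on $\mathbb R^d$. Lower-orthant scores: for finite $t\in\mathbb R^d$ with $t\ge\underline x$, let $\Theta_t:=[\underline x,t]$ with Lebesgue measure $\lambda_t$. For $z\in\Theta_t$ and $x\in D$ set $s_z(x):=1-\mathbf 1_{\{x\le z\}}$; for $x\notin D$ set $s_z(x):=1-\mathbf 1_{\{\Pi_D(x)\le z\}}$, with $\Pi_D$ the coordinatewise projection onto $D$. Write $s^{(t)}=(s_z)_{z\in\Theta_t}$. For $\gamma\in[0,1]$, $P\preceq_{s^{(t)},\lambda_t,\gamma}^{\rm CSD}Q$ means that there exists $\kappa\in\mathcal C(P,Q)$ with $$\int_{D\times D}\int_{\Theta_t}(s_z(x)-s_z(y))_+\,dz\,\kappa(dx,dy)\le\gamma\int_{D\times D}\int_{\Theta_t}(s_z(y)-s_z(x))_+\,dz\,\kappa(dx,dy).$$ Lower-orthant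 CSD holds at tolerance $\gamma$ if $P\preceq_{s^{(t)},\lambda_t,\gamma}^{\rm CSD}Q$ for every finite $t\ge\underline x$ (the coupling may depend on $t$). FOSD: $Q$ dominates $P$ by FOSD if $P(A)\ge Q(A)$ for every closed lower set $A\subseteq\mathbb R^d$ (a set such that $x\in A$, $y\le x$ imply $y\in A$); by Strassen's theorem (known) this is equivalent to existence of $\kappa\in\mathcal C(P,Q)$ with $x\le y$ $\kappa$-a.s. Second-degree lower-orthant dominance of $Q$ over $P$: $\int_{(-\infty,t]}F_Q(z)\,dz\le\int_{(-\infty,t]}F_P(z)\,dz$ for every $t\in\mathbb R^d$. $(1+\gamma)$-stochastic dominance ($d=1$; Müller, Scarsini, Tsetlin and Winkler): $\int u\,dP\le\int u\,dQ$ for every increasing (nondecreasing, differentiable) utility $u$ with $0\le\gamma u'(y)\le u'(x)$ whenever $x\le y$. By the known integral characterization from their work, this is equivalent to $$\int_{\underline x}^{t}\{F_Q(z)-F_P(z)\}_+\,dz\le\gamma\int_{\underline x}^{t}\{F_P(z)-F_Q(z)\}_+\,dz\quad\text{for every }t\in\mathbb R.$$ *)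

theory Defs
  imports "HOL-Probability.Probability"
begin

text \<open>
  The space \<open>\<real>\<^sup>d\<close> is a type of class \<open>ordered_euclidean_space\<close>, whose order, \<open>inf\<close> and \<open>sup\<close> are
  coordinatewise and whose intervals \<open>{a..b}\<close> are closed rectangles; both \<open>real\<close> and \<open>real ^ 'n\<close>
  are instances. In all dominance relations below the argument order is \<open>P Q\<close>, read as
  ``\<open>Q\<close> dominates \<open>P\<close>''.
\<close>

definition msupport :: "'a::topological_space measure \<Rightarrow> 'a set" where
  "msupport P = {x. \<forall>U. open U \<and> x \<in> U \<longrightarrow> 0 < emeasure P U}"

definition borel_law_on :: "'a::topological_space set \<Rightarrow> 'a measure \<Rightarrow> bool" where
  "borel_law_on D P \<longleftrightarrow> prob_space P \<and> sets P = sets borel \<and> msupport P \<subseteq> D"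

definition nondegenerate_rect :: "'a::euclidean_space \<Rightarrow> 'a \<Rightarrow> bool" where
  "nondegenerate_rect xl xu \<longleftrightarrow> (\<forall>i\<in>Basis. xl \<bullet> i < xu \<bullet> i)"

definition couplings :: "'a measure \<Rightarrow> 'b measure \<Rightarrow> ('a \<times> 'b) measure set" where
  "couplings P Q = {\<kappa>. prob_space \<kappa> \<and> sets \<kappa> = sets (P \<Otimes>\<^sub>M Q)
                       \<and> distr \<kappa> P fst = P \<and> distr \<kappa> Q snd = Q}"

definition csd ::
  "'a set \<Rightarrow> ('i \<Rightarrow> 'a \<Rightarrow> real) \<Rightarrow> 'i measure \<Rightarrow> real \<Rightarrow> 'a measure \<Rightarrow> 'a measure \<Rightarrow> bool" where
  "csd D s \<mu> \<gamma> P Q \<longleftrightarrow>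
     (\<exists>\<kappa>\<in>couplings P Q.
        (LINT p:(D \<times> D)|\<kappa>. (LINT z|\<mu>. max (s z (fst p) - s z (snd p)) 0))
        \<le> \<gamma> * (LINT p:(D \<times> D)|\<kappa>. (LINT z|\<mu>. max (s z (snd p) - s z (fst p)) 0)))"

definition rect_proj :: "'a::ordered_euclidean_space \<Rightarrow> 'a \<Rightarrow> 'a \<Rightarrow> 'a" where
  "rect_proj xl xu x = sup xl (inf x xu)"

definition lower_orthant_score :: "'a::ordered_euclidean_space \<Rightarrow> 'a \<Rightarrow> 'a \<Rightarrow> 'a \<Rightarrow> real" where
  "lower_orthant_score xl xu z x =
     (if x \<in> {xl..xu} then 1 - indicator {..z} x
      else 1 - indicator {..z} (rect_proj xl xu x))"

definition lower_orthant_csd ::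
  "'a::ordered_euclidean_space \<Rightarrow> 'a \<Rightarrow> real \<Rightarrow> 'a measure \<Rightarrow> 'a measure \<Rightarrow> bool" where
  "lower_orthant_csd xl xu \<gamma> P Q \<longleftrightarrow>
     (\<forall>t\<ge>xl. csd {xl..xu} (lower_orthant_score xl xu) (restrict_space lborel {xl..t}) \<gamma> P Q)"

definition fosd :: "'a::ordered_euclidean_space measure \<Rightarrow> 'a measure \<Rightarrow> bool" where
  "fosd P Q \<longleftrightarrow>
     (\<forall>A. closed A \<and> (\<forall>x\<in>A. \<forall>y\<le>x. y \<in> A) \<longrightarrow> measure P A \<ge> measure Q A)"

text \<open>The library constant \<open>cdf\<close> covers only measures on the reals.\<close>

definition dist_fun :: "'a::ordered_euclidean_space measure \<Rightarrow> 'a \<Rightarrow> real" where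
  "dist_fun R t = measure R {..t}"

definition lower_orthant_sd2 :: "'a::ordered_euclidean_space measure \<Rightarrow> 'a measure \<Rightarrow> bool" where
  "lower_orthant_sd2 P Q \<longleftrightarrow>
     (\<forall>t. (LINT z:{..t}|lborel. dist_fun Q z) \<le> (LINT z:{..t}|lborel. dist_fun P z))"

text \<open>The \<open>(1 + \<gamma>)\<close>-stochastic dominance of Mueller, Scarsini, Tsetlin and Winkler,
  with \<open>u'\<close> the derivative of the utility \<open>u\<close>.\<close>

definition one_plus_sd :: "real \<Rightarrow> real measure \<Rightarrow> real measure \<Rightarrow> bool" where
  "one_plus_sd \<gamma> P Q \<longleftrightarrow>
     (\<forall>u u' :: real \<Rightarrow> real.
        mono u \<and> (\<forall>x. (u has_real_derivative u' x) (at x)) \<and>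
        (\<forall>x y. x \<le> y \<longrightarrow> 0 \<le> \<gamma> * u' y \<and> \<gamma> * u' y \<le> u' x)
        \<longrightarrow> (LINT x|P. u x) \<le> (LINT x|Q. u x))"

end

theory Submission
  imports Defs
begin

text \<open>
  For a coupling \<open>\<kappa>\<close> Fubini turns the two sides of the CSD inequality into the integrals over
  \<open>[xl, t]\<close> of \<open>gap z = \<kappa>{y \<le> z, \<not> x \<le> z}\<close> and \<open>gain z = \<kappa>{x \<le> z, \<not> y \<le> z}\<close>, and
  \<open>gap - gain = F\<^sub>Q - F\<^sub>P\<close> for every coupling. For \<open>\<gamma> = 1\<close> only this difference
  matters. For \<open>\<gamma> = 0\<close> and \<open>t\<close> beyond \<open>xu\<close> the gap integral vanishes iff \<open>x \<le> y\<close> almost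
  surely, so the claim is Strassen's theorem on a box. Strassen's theorem is obtained from a finite
  transport problem on dyadic grids, solved by minimising the squared marginal error, and a
  projective limit.

  In dimension one the comonotone coupling minimises the gap pointwise, so CSD says
  \<open>\<integral> g\<^sub>- \<le> \<gamma> \<integral> g\<^sub>+\<close> over every \<open>[xl, t]\<close> for \<open>g = F\<^sub>P - F\<^sub>Q\<close>, while the utility comparison says
  \<open>\<integral> u' g \<ge> 0\<close>. The former gives the latter by the second mean value theorem applied to the running
  infimum of \<open>u'\<close>; conversely one tests with continuous approximations of the \<open>u'\<close> that is
  \<open>\<gamma>\<close> on \<open>{g > 0}\<close>, \<open>1\<close> on \<open>{g \<le> 0}\<close> and \<open>0\<close> beyond \<open>t\<close>.
\<close>

section \<open>Finite transport problems\<close>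

text \<open>Tychonoff's theorem for the topology carried by the function type. It serves the
  transport weights below and, later, the family of grid laws before the projective limit.\<close>

lemma compact_PiE_UNIV:
  fixes S :: "'i \<Rightarrow> 'b::topological_space set"
  assumes "\<And>i. compact (S i)"
  shows "compact (PiE UNIV S)"
proof -
  have "compactin (product_topology (\<lambda>i. euclidean) UNIV) (PiE UNIV S)"
    using assms by (simp add: compactin_PiE)
  then show ?thesis
    by (simp add: euclidean_product_topology)
qed

text \<open>A supply-demand form of Hall's theorem. Among the admissible plans with correct row
  sums, compactness gives one of least squared column error. Rows that can reach an underfilled
  column of that plan send all their mass to underfilled columns, so Hall's inequality rules such
  columns out.\<close>

lemma finite_transport:
  fixes p :: "'i \<Rightarrow> real" and q :: "'j \<Rightarrow> real" and R :: "'i \<Rightarrow> 'j \<Rightarrow> bool"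
  assumes fin: "finite I" "finite J"
    and p0: "\<And>i. i \<in> I \<Longrightarrow> 0 \<le> p i"
    and tot: "sum p I = sum q J"
    and out: "\<And>i. i \<in> I \<Longrightarrow> \<exists>j\<in>J. R i j"
    and hall: "\<And>U. U \<subseteq> J \<Longrightarrow> sum q U \<le> sum p {i\<in>I. \<exists>j\<in>U. R i j}"
  obtains w :: "'i \<Rightarrow> 'j \<Rightarrow> real" where
    "\<And>i j. 0 \<le> w i j" "\<And>i j. w i j \<noteq> 0 \<Longrightarrow> i \<in> I \<and> j \<in> J \<and> R i j"
    "\<And>i. i \<in> I \<Longrightarrow> (\<Sum>j\<in>J. w i j) = p i" "\<And>j. j \<in> J \<Longrightarrow> (\<Sum>i\<in>I. w i j) = q j"
proof -
  \<comment> \<open>The cap \<open>p (fst c)\<close> follows from the row sums and makes the set of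
    plans compact; forbidden pairs get the interval \<open>{0}\<close>.\<close>
  define S where "S c = (if fst c \<in> I \<and> snd c \<in> J \<and> R (fst c) (snd c) then {0..p (fst c)} else {0::real})"
    for c
  define K where "K = PiE UNIV S \<inter> (\<Inter>i\<in>I. {w. (\<Sum>j\<in>J. w (i, j)) = p i})"
  define e where "e w j = (\<Sum>i\<in>I. w (i, j)) - q j" for w :: "'i \<times> 'j \<Rightarrow> real" and j
  define \<Phi> where "\<Phi> w = (\<Sum>j\<in>J. (e w j)\<^sup>2)" for w
  have coord: "continuous_on UNIV (\<lambda>w::'i \<times> 'j \<Rightarrow> real. w c)" for c
    by (rule continuous_on_product_coordinates)
  have cpt: "compact K"
    unfolding K_def
    by (intro compact_Int_closed compact_PiE_UNIV closed_INT ballI closed_Collect_eq continuous_on_sum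
         coord continuous_on_const) (auto simp: S_def)
  \<comment> \<open>A feasible plan: row \<open>i\<close> ships all of \<open>p i\<close> to one
    permitted column \<open>r i\<close>.\<close>
  from out obtain r where r: "\<And>i. i \<in> I \<Longrightarrow> r i \<in> J \<and> R i (r i)" by metis
  have "(\<lambda>(i, j). if i \<in> I \<and> j = r i then p i else 0) \<in> K"
    using fin r p0 by (auto simp: K_def S_def)
  then have "K \<noteq> {}" by auto
  moreover have "continuous_on K \<Phi>"
    unfolding \<Phi>_def e_def
    by (intro continuous_intros continuous_on_sum continuous_on_subset[OF coord]) auto
  ultimately obtain w where wK: "w \<in> K" and wmin: "\<And>v. v \<in> K \<Longrightarrow> \<Phi> w \<le> \<Phi> v"
    using continuous_attains_inf[OF cpt] by blast
  have w0: "0 \<le> w c" for c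
    using wK p0 unfolding K_def S_def by (cases c) (force simp: PiE_iff split: if_splits)
  have wR: "i \<in> I \<and> j \<in> J \<and> R i j" if "w (i, j) \<noteq> 0" for i j
    using wK that unfolding K_def S_def by (auto simp: PiE_iff split: if_splits)
  have wp: "(\<Sum>j\<in>J. w (i, j)) = p i" if "i \<in> I" for i
    using wK that by (auto simp: K_def)
  \<comment> \<open>First-order optimality: moving mass inside a row from \<open>j\<close> to \<open>j'\<close> cannot decrease \<open>\<Phi>\<close>.\<close>
  have kkt: "e w j \<le> e w j'" if "w (i, j) > 0" "R i j'" "j' \<in> J" for i j j'
  proof (cases "j = j'")
    case False
    have ij: "i \<in> I" "j \<in> J" "R i j" using wR[of i j] that by auto
    have small: "e w j - e w j' \<le> t" if t: "0 < t" "t \<le> w (i, j)" for t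
    proof -
      \<comment> \<open>\<open>d\<close> is the direction of the move, so \<open>v\<close> below is
        \<open>w\<close> with mass \<open>t\<close> shifted from \<open>j\<close> to
        \<open>j'\<close> within row \<open>i\<close>.\<close>
      define d :: "'j \<Rightarrow> real" where "d k = (if k = j' then 1 else 0) - (if k = j then 1 else 0)" for k
      have dsum: "(\<Sum>k\<in>J. f k * d k) = f j' - f j" for f
        unfolding d_def right_diff_distrib sum_subtractf mult_delta_right
        using fin ij \<open>j' \<in> J\<close> by simp
      define v where "v c = w c + (if fst c = i then t * d (snd c) else 0)" for c
      have row: "(\<Sum>k\<in>J. v (l, k)) = p l" if "l \<in> I" for l
        using wp[OF that] dsum[of "\<lambda>_. t"] by (cases "l = i") (simp_all add: v_def sum.distrib)
      have v0: "0 \<le> v c" for c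
        using w0[of c] t False by (cases c) (auto simp: v_def d_def)
      have vR: "v c = 0" if "\<not> (fst c \<in> I \<and> snd c \<in> J \<and> R (fst c) (snd c))" for c
        using that ij \<open>j' \<in> J\<close> \<open>R i j'\<close> wR[of "fst c" "snd c"] by (auto simp: v_def d_def)
      have "v (l, k) \<le> p l" if "l \<in> I" "k \<in> J" for l k
        using member_le_sum[of k J "\<lambda>k. v (l, k)"] fin v0 row that by auto
      then have "v \<in> K"
        using v0 vR row by (auto simp: K_def S_def)
      from wmin[OF this] have "\<Phi> w \<le> \<Phi> v" .
      moreover have "e v k = e w k + t * d k" if "k \<in> J" for k
        using fin ij by (simp add: e_def v_def sum.distrib)
      then have "\<Phi> v = (\<Sum>k\<in>J. (e w k)\<^sup>2 + 2 * t * (e w k * d k) + t\<^sup>2 * (d k)\<^sup>2)"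
        unfolding \<Phi>_def by (intro sum.cong) (auto simp: power2_eq_square algebra_simps)
      also have "\<dots> = \<Phi> w + 2 * t * (\<Sum>k\<in>J. e w k * d k) + t\<^sup>2 * (\<Sum>k\<in>J. (d k)\<^sup>2)"
        by (simp add: \<Phi>_def sum.distrib sum_distrib_left)
      also have "(\<Sum>k\<in>J. e w k * d k) = e w j' - e w j"
        by (rule dsum)
      also have "(\<Sum>k\<in>J. (d k)\<^sup>2) = (\<Sum>k\<in>J. (if k = j' then 1 else 0) + (if k = j then 1 else 0))"
        using False by (intro sum.cong) (auto simp: d_def)
      also have "\<dots> = 2"
        using fin ij \<open>j' \<in> J\<close> by (simp add: sum.distrib)
      finally have "0 \<le> t * (2 * (e w j' - e w j) + 2 * t)"
        using \<open>\<Phi> w \<le> \<Phi> v\<close> by (simp add: power2_eq_square algebra_simps)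
      then show ?thesis
        using t by (simp add: zero_le_mult_iff)
    qed
    show ?thesis
    proof (rule ccontr)
      assume "\<not> ?thesis"
      \<comment> \<open>At this \<open>t\<close>, \<open>small\<close> would bound the positive
        difference by half of itself.\<close>
      then have "0 < min (w (i, j)) ((e w j - e w j') / 2)" using that(1) by simp
      from small[OF this] \<open>\<not> ?thesis\<close> show False by simp
    qed
  qed auto
  define U where "U = {j\<in>J. e w j < 0}"
  have esum: "sum (e w) J = 0"
  proof -
    have "sum (e w) J = (\<Sum>i\<in>I. \<Sum>j\<in>J. w (i, j)) - sum q J"
      unfolding e_def sum_subtractf by (subst sum.swap) simp
    then show ?thesis using wp tot by simp
  qed
  have "U = {}"
  proof (rule ccontr)
    assume ne: "U \<noteq> {}"
    define N where "N = {i\<in>I. \<exists>j\<in>U. R i j}"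
    have UJ: "U \<subseteq> J" "finite U" "N \<subseteq> I" "finite N" using fin by (auto simp: U_def N_def)
    \<comment> \<open>A column outside \<open>U\<close> has nonnegative error, one in
      \<open>U\<close> negative error; by \<open>kkt\<close> a row that can reach \<open>U\<close>
      cannot use the former.\<close>
    have "w (i, j) = 0" if iN: "i \<in> N" and jU: "j \<in> J - U" for i j
    proof (rule ccontr)
      assume "w (i, j) \<noteq> 0"
      then have "w (i, j) > 0" using w0[of "(i, j)"] by simp
      moreover obtain j' where "j' \<in> U" "R i j'" using iN by (auto simp: N_def)
      ultimately show False using kkt[of i j j'] jU by (auto simp: U_def)
    qed
    then have "p i = (\<Sum>j\<in>U. w (i, j))" if "i \<in> N" for i
      using wp[of i] that UJ fin sum.mono_neutral_right[of J U "\<lambda>j. w (i, j)"] by (auto simp: N_def)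
    then have "sum p N = (\<Sum>j\<in>U. \<Sum>i\<in>N. w (i, j))"
      by (subst sum.swap) simp
    also have "\<dots> \<le> (\<Sum>j\<in>U. \<Sum>i\<in>I. w (i, j))"
      using UJ fin w0 by (intro sum_mono sum_mono2) auto
    also have "\<dots> = sum (e w) U + sum q U"
      by (simp add: e_def sum.distrib[symmetric])
    also have "\<dots> < sum q U"
    proof -
      have "sum (e w) U < (\<Sum>j\<in>U. 0)"
        by (rule sum_strict_mono) (use UJ(2) ne in \<open>auto simp: U_def\<close>)
      then show ?thesis by simp
    qed
    also have "\<dots> \<le> sum p N"
      unfolding N_def using hall[of U] UJ by simp
    finally show False by simp
  qed
  \<comment> \<open>The column errors sum to zero because total supply equals total demand, so
    nonnegative errors all vanish.\<close>
  then have "e w j \<ge> 0" if "j \<in> J" for j using that by (auto simp: U_def not_less)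
  then have "e w j = 0" if "j \<in> J" for j
    using esum that fin by (simp add: sum_nonneg_eq_0_iff)
  then show ?thesis
    by (intro that[of "\<lambda>i j. w (i, j)"]) (use w0 wR wp in \<open>auto simp: e_def\<close>)
qed

section \<open>Dyadic grids and discrete couplings\<close>

text \<open>Every point outside the support has an open null neighbourhood, and by the Lindelof
  property countably many of these cover the complement.\<close>

lemma borel_law_on_AE:
  fixes D :: "'a::second_countable_topology set"
  assumes "borel_law_on D P"
  shows "AE x in P. x \<in> D"
proof -
  have sets: "sets P = sets borel" and D: "msupport P \<subseteq> D"
    using assms by (auto simp: borel_law_on_def)
  let ?F = "{U. open U \<and> emeasure P U = 0}"
  obtain F where F: "F \<subseteq> ?F" "countable F" "\<Union>F = \<Union>?F"
    using Lindelof[of ?F] by auto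
  have "\<Union>F \<in> null_sets P"
  proof -
    have "U \<in> null_sets P" if "U \<in> F" for U
      using F(1) that sets by (auto simp: null_sets_def)
    with null_sets_UN'[OF F(2), of "\<lambda>U. U"] show ?thesis by simp
  qed
  moreover have "-D \<subseteq> \<Union>F"
    using D F(3) by (auto simp: msupport_def zero_less_iff_neq_zero)
  ultimately show ?thesis
    by (intro AE_I'[of "\<Union>F"]) auto
qed

section \<open>Dyadic rounding\<close>

definition grid_up :: "nat \<Rightarrow> 'a::ordered_euclidean_space \<Rightarrow> 'a" where
  "grid_up n x = (\<Sum>i\<in>Basis. (of_int \<lceil>2 ^ n * (x \<bullet> i)\<rceil> / 2 ^ n) *\<^sub>R i)"

lemma grid_up_inner: "i \<in> Basis \<Longrightarrow> grid_up n x \<bullet> i = of_int \<lceil>2 ^ n * (x \<bullet> i)\<rceil> / 2 ^ n"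
  by (simp add: grid_up_def)

lemma grid_up_mono: "x \<le> y \<Longrightarrow> grid_up n x \<le> grid_up n y"
  by (auto simp: eucl_le[where 'a='a] grid_up_inner divide_right_mono ceiling_mono)

text \<open>The reason for rounding up: together with monotonicity and idempotence,
  \<open>grid_up n x \<le> b\<close> and \<open>x \<le> b\<close> become equivalent for a grid point
  \<open>b\<close>, so orthants with grid corners are unions of rounding cells.\<close>

lemma grid_up_ge: "x \<le> grid_up n x"
proof -
  have "x \<bullet> i \<le> of_int \<lceil>2 ^ n * (x \<bullet> i)\<rceil> / 2 ^ n" for i
    using le_of_int_ceiling[of "2 ^ n * (x \<bullet> i)"] by (simp add: field_simps)
  then show ?thesis by (auto simp: eucl_le[where 'a='a] grid_up_inner)
qed

text \<open>With \<open>k = 2 ^ (n - m)\<close>, both ceilings have the same integer upper bounds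
  \<open>z\<close>: since \<open>z * k\<close> is an integer, it bounds \<open>2 ^ n * r\<close>
  exactly when it bounds the ceiling of \<open>2 ^ n * r\<close>.\<close>

lemma grid_up_grid_up:
  assumes "m \<le> n"
  shows "grid_up m (grid_up n x) = grid_up m x"
proof -
  have "\<lceil>2 ^ m * (real_of_int \<lceil>2 ^ n * r\<rceil> / 2 ^ n)\<rceil> = \<lceil>2 ^ m * r\<rceil>" for r :: real
  proof -
    define k :: int where "k = 2 ^ (n - m)"
    have k: "k > 0" by (simp add: k_def)
    have n: "(2::real) ^ n = 2 ^ m * of_int k"
      using assms by (simp add: k_def flip: power_add)
    have "\<lceil>2 ^ m * (real_of_int \<lceil>2 ^ n * r\<rceil> / 2 ^ n)\<rceil> = \<lceil>of_int \<lceil>2 ^ n * r\<rceil> / real_of_int k\<rceil>"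
      unfolding n by simp
    also have "\<dots> \<le> z \<longleftrightarrow> \<lceil>2 ^ m * r\<rceil> \<le> z" for z
    proof -
      have "\<lceil>of_int \<lceil>2 ^ n * r\<rceil> / real_of_int k\<rceil> \<le> z \<longleftrightarrow> real_of_int \<lceil>2 ^ n * r\<rceil> \<le> of_int (z * k)"
        using k by (simp add: ceiling_le_iff field_simps)
      also have "\<dots> \<longleftrightarrow> 2 ^ n * r \<le> of_int (z * k)"
        by (simp only: of_int_le_iff ceiling_le_iff)
      also have "\<dots> \<longleftrightarrow> \<lceil>2 ^ m * r\<rceil> \<le> z"
        using k by (simp add: n ceiling_le_iff mult_ac)
      finally show ?thesis .
    qed
    then have "\<lceil>of_int \<lceil>2 ^ n * r\<rceil> / real_of_int k\<rceil> = \<lceil>2 ^ m * r\<rceil>"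
      by (meson order.antisym order_refl)
    finally show ?thesis .
  qed
  then show ?thesis
    by (subst euclidean_eq_iff) (simp add: grid_up_inner)
qed

lemma dist_grid_up: "dist (grid_up n x) (x::'a::ordered_euclidean_space) \<le> DIM('a) / 2 ^ n"
proof -
  have "\<bar>(grid_up n x - x) \<bullet> i\<bar> \<le> 1 / 2 ^ n" if "i \<in> Basis" for i
  proof -
    have "(grid_up n x - x) \<bullet> i = (of_int \<lceil>2 ^ n * (x \<bullet> i)\<rceil> - 2 ^ n * (x \<bullet> i)) / 2 ^ n"
      using that by (simp add: grid_up_inner inner_diff_left field_simps)
    moreover have "\<bar>of_int \<lceil>2 ^ n * (x \<bullet> i)\<rceil> - 2 ^ n * (x \<bullet> i)\<bar> \<le> 1"
      using ceiling_correct[of "2 ^ n * (x \<bullet> i)"] by linarith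
    ultimately show ?thesis by (simp add: divide_right_mono)
  qed
  then have "(\<Sum>i\<in>Basis. \<bar>(grid_up n x - x) \<bullet> i\<bar>) \<le> (\<Sum>i\<in>(Basis::'a set). 1 / 2 ^ n)"
    by (rule sum_mono)
  then show ?thesis
    using norm_le_l1[of "grid_up n x - x"] by (simp add: dist_norm)
qed

lemma grid_up_tendsto: "(\<lambda>n. grid_up n x) \<longlonglongrightarrow> (x::'a::ordered_euclidean_space)"
proof -
  have "(\<lambda>n. DIM('a) / 2 ^ n) \<longlonglongrightarrow> (0::real)"
    by (rule LIMSEQ_divide_realpow_zero) simp
  then have "(\<lambda>n. dist (grid_up n x) x) \<longlonglongrightarrow> 0"
    by (rule Lim_null_comparison[rotated]) (simp add: dist_grid_up)
  then show ?thesis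
    by (simp add: tendsto_dist_iff[of "\<lambda>n. grid_up n x"])
qed

lemma measurable_grid_up[measurable]: "grid_up n \<in> borel_measurable borel"
  unfolding grid_up_def[abs_def] by measurable

lemma finite_grid_up: "finite (grid_up n ` {a..b::'a::ordered_euclidean_space})"
proof (rule finite_subset)
  let ?K = "PiE (Basis::'a set) (\<lambda>i. {\<lceil>2 ^ n * (a \<bullet> i)\<rceil>..\<lceil>2 ^ n * (b \<bullet> i)\<rceil>})"
  show "finite ((\<lambda>k. \<Sum>i\<in>Basis. (of_int (k i) / 2 ^ n) *\<^sub>R i) ` ?K :: 'a set)"
    by (intro finite_imageI finite_PiE) auto
  show "grid_up n ` {a..b} \<subseteq> (\<lambda>k. \<Sum>i\<in>Basis. (of_int (k i) / 2 ^ n) *\<^sub>R i) ` ?K"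
  proof
    fix y assume "y \<in> grid_up n ` {a..b}"
    then obtain x where x: "x \<in> {a..b}" "y = grid_up n x" by auto
    then show "y \<in> (\<lambda>k. \<Sum>i\<in>Basis. (of_int (k i) / 2 ^ n) *\<^sub>R i) ` ?K"
      by (intro image_eqI[of _ _ "restrict (\<lambda>i. \<lceil>2 ^ n * (x \<bullet> i)\<rceil>) Basis"])
         (auto simp: grid_up_def eucl_le[where 'a='a] intro!: ceiling_mono)
  qed
qed

section \<open>Finitely supported laws\<close>

lemma finite_support_measure_eqI:
  fixes M N :: "'a::t1_space measure"
  assumes "finite_measure M" "finite_measure N" "sets M = sets borel" "sets N = sets borel"
    and G: "finite G" "AE x in M. x \<in> G" "AE x in N. x \<in> G"
    and eq: "\<And>a. a \<in> G \<Longrightarrow> measure M {a} = measure N {a}"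
  shows "M = N"
proof (rule measure_eqI)
  interpret M: finite_measure M by fact
  interpret N: finite_measure N by fact
  fix A assume A: "A \<in> sets M"
  note [measurable_cong] = assms(3,4)
  have AG: "A \<inter> G \<in> sets borel" "A \<in> sets borel"
    using A assms(3) G(1) by (auto intro: borel_closed finite_imp_closed)
  have "measure M A = measure M (A \<inter> G)"
    using G(2) AG assms(3) by (intro M.finite_measure_eq_AE) auto
  also have "\<dots> = (\<Sum>a\<in>A \<inter> G. measure M {a})"
    using G(1) assms(3) by (intro M.finite_measure_eq_sum_singleton) auto
  also have "\<dots> = (\<Sum>a\<in>A \<inter> G. measure N {a})"
    using eq by simp
  also have "\<dots> = measure N (A \<inter> G)"
    using G(1) assms(4) by (intro N.finite_measure_eq_sum_singleton[symmetric]) auto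
  also have "\<dots> = measure N A"
    using G(3) AG assms(4) by (intro N.finite_measure_eq_AE) auto
  finally show "emeasure M A = emeasure N A"
    by (simp add: M.emeasure_eq_measure N.emeasure_eq_measure)
qed (simp add: assms)

lemma pmf_of_finite_weights:
  fixes f :: "'a \<Rightarrow> real"
  assumes "finite C" "\<And>c. 0 \<le> f c" "\<And>c. c \<notin> C \<Longrightarrow> f c = 0" "sum f C = 1"
  obtains p where "\<And>c. pmf p c = f c"
proof -
  have "(\<integral>\<^sup>+c. ennreal (f c) \<partial>count_space UNIV) = (\<Sum>c\<in>C. ennreal (f c))"
    using assms by (intro nn_integral_count_space') auto
  also have "\<dots> = 1"
    using assms by (simp add: sum_ennreal)
  finally show ?thesis
    using that[of "embed_pmf f"] assms by (simp add: pmf_embed_pmf)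
qed

lemma pmf_map_finite:
  assumes "finite C" "set_pmf p \<subseteq> C"
  shows "pmf (map_pmf f p) a = (\<Sum>c\<in>{c\<in>C. f c = a}. pmf p c)"
proof -
  have "pmf (map_pmf f p) a = measure p (f -` {a} \<inter> set_pmf p)"
    by (simp add: pmf_map measure_Int_set_pmf)
  also have "f -` {a} \<inter> set_pmf p = {c\<in>C. f c = a} \<inter> set_pmf p"
    using assms by auto
  also have "measure p \<dots> = measure p {c\<in>C. f c = a}"
    by (rule measure_Int_set_pmf)
  finally show ?thesis
    using assms by (simp add: measure_measure_pmf_finite)
qed

text \<open>The monotone rounding map \<open>e\<close> reduces the laws to finitely many points, and
  FOSD becomes Hall's condition for the order relation: a set \<open>U\<close> of grid points is
  compared with the closed lower set that it generates.\<close>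

lemma fosd_discrete_coupling:
  fixes e :: "'a::ordered_euclidean_space \<Rightarrow> 'a"
  assumes P: "prob_space P" "sets P = sets borel" "AE x in P. x \<in> D"
    and Q: "prob_space Q" "sets Q = sets borel" "AE x in Q. x \<in> D"
    and fosd: "fosd P Q"
    and e[measurable]: "e \<in> borel_measurable borel" and mono: "\<And>x y. x \<le> y \<Longrightarrow> e x \<le> e y"
    and up: "\<And>x. x \<le> e x" and idem: "\<And>x. e (e x) = e x" and fin: "finite (e ` D)"
  obtains W :: "('a \<times> 'a) pmf" where
    "set_pmf W \<subseteq> e ` D \<times> e ` D" "\<And>a b. (a, b) \<in> set_pmf W \<Longrightarrow> a \<le> b"
    "distr (measure_pmf W) borel fst = distr P borel e"
    "distr (measure_pmf W) borel snd = distr Q borel e"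
proof -
  interpret P: prob_space P by fact
  interpret Q: prob_space Q by fact
  have [measurable_cong]: "sets P = sets borel" "sets Q = sets borel" by fact+
  have spc: "space P = UNIV" "space Q = UNIV"
    using P(2) Q(2) by (auto dest: sets_eq_imp_space_eq)
  interpret Pe: prob_space "distr P borel e" by (rule P.prob_space_distr) simp
  interpret Qe: prob_space "distr Q borel e" by (rule Q.prob_space_distr) simp
  define G where "G = e ` D"
  define p where "p a = measure (distr P borel e) {a}" for a
  define q where "q a = measure (distr Q borel e) {a}" for a
  have G: "finite G" using fin by (simp add: G_def)
  have Gm: "S \<in> sets borel" if "S \<subseteq> G" for S
    using finite_subset[OF that G] by (intro borel_closed finite_imp_closed)
  have psum: "sum p S = measure P {x. e x \<in> S}" if "S \<subseteq> G" for S
  proof -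
    have "sum p S = measure (distr P borel e) S"
      unfolding p_def by (rule Pe.finite_measure_eq_sum_singleton[symmetric]) (use finite_subset[OF that G] in auto)
    also have "\<dots> = measure P {x. e x \<in> S}"
      using Gm[OF that] by (simp add: measure_distr spc vimage_def)
    finally show ?thesis .
  qed
  have qsum: "sum q S = measure Q {x. e x \<in> S}" if "S \<subseteq> G" for S
  proof -
    have "sum q S = measure (distr Q borel e) S"
      unfolding q_def by (rule Qe.finite_measure_eq_sum_singleton[symmetric]) (use finite_subset[OF that G] in auto)
    also have "\<dots> = measure Q {x. e x \<in> S}"
      using Gm[OF that] by (simp add: measure_distr spc vimage_def)
    finally show ?thesis .
  qed
  have AE_P: "AE x in P. e x \<in> G" and AE_Q: "AE x in Q. e x \<in> G"
    using P(3) Q(3) by (auto simp: G_def)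
  have p1: "sum p G = 1"
    using AE_P Gm[of G] by (subst psum) (auto intro!: P.prob_eq_1[THEN iffD2] simp: spc)
  have q1: "sum q G = 1"
    using AE_Q Gm[of G] by (subst qsum) (auto intro!: Q.prob_eq_1[THEN iffD2] simp: spc)
  have hall: "sum q U \<le> sum p {i\<in>G. \<exists>j\<in>U. i \<le> j}" if U: "U \<subseteq> G" for U
  proof -
    \<comment> \<open>\<open>?A\<close> contains the event \<open>e x \<in> U\<close> because
      \<open>x \<le> e x\<close>, and is almost surely contained in the event
      \<open>e x \<in> ?N\<close>; FOSD compares its two probabilities.\<close>
    let ?A = "\<Union>b\<in>U. {..b}" and ?N = "{i\<in>G. \<exists>j\<in>U. i \<le> j}"
    have finU: "finite U" using U G by (rule finite_subset)
    have clA: "closed ?A" using finU by (intro closed_UN) (auto simp: closed_eucl_atMost)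
    then have [measurable]: "?A \<in> sets borel" by (rule borel_closed)
    have [measurable]: "?N \<in> sets borel" by (rule Gm) auto
    have "sum q U = measure Q {x. e x \<in> U}" using U by (rule qsum)
    also have "\<dots> \<le> measure Q ?A"
      using up by (intro Q.finite_measure_mono) auto
    also have "\<dots> \<le> measure P ?A"
    proof -
      have "\<forall>x\<in>?A. \<forall>y\<le>x. y \<in> ?A" by (auto intro: order.trans)
      with clA show ?thesis using fosd unfolding fosd_def by (metis (no_types))
    qed
    also have "\<dots> \<le> measure P {x. e x \<in> ?N}"
    proof (rule P.finite_measure_mono_AE)
      show "AE x in P. x \<in> ?A \<longrightarrow> x \<in> {x. e x \<in> ?N}"
        using AE_P
      proof eventually_elim
        case (elim x)
        \<comment> \<open>Idempotence fixes the grid point \<open>b\<close>, so applying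
          \<open>e\<close> to \<open>x \<le> b\<close> leaves the right side unchanged.\<close>
        have "e x \<le> b" if "b \<in> U" "x \<le> b" for b
        proof -
          have "e b = b" using that U idem by (auto simp: G_def)
          then show ?thesis using mono[OF that(2)] by simp
        qed
        then show ?case using elim by auto
      qed
      show "{x. e x \<in> ?N} \<in> sets P" by measurable
    qed
    also have "\<dots> = sum p ?N" by (rule psum[symmetric]) auto
    finally show ?thesis .
  qed
  obtain w where w: "\<And>i j. 0 \<le> w i j" "\<And>i j. w i j \<noteq> 0 \<Longrightarrow> i \<in> G \<and> j \<in> G \<and> i \<le> j"
    "\<And>i. i \<in> G \<Longrightarrow> (\<Sum>j\<in>G. w i j) = p i" "\<And>j. j \<in> G \<Longrightarrow> (\<Sum>i\<in>G. w i j) = q j"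
    by (rule finite_transport[of G G p q "(\<le>)"]) (use G p1 q1 hall in \<open>auto simp: p_def\<close>)
  have "(\<Sum>c\<in>G \<times> G. w (fst c) (snd c)) = (\<Sum>i\<in>G. \<Sum>j\<in>G. w i j)"
    by (simp add: sum.cartesian_product case_prod_beta)
  also have "\<dots> = 1" using w(3) p1 by simp
  finally obtain W where W: "\<And>c. pmf W c = w (fst c) (snd c)"
    using pmf_of_finite_weights[of "G \<times> G" "\<lambda>c. w (fst c) (snd c)"] G w(1,2)
    by (metis finite_cartesian_product mem_Times_iff)
  have sub: "set_pmf W \<subseteq> G \<times> G" using w(2) by (auto simp: set_pmf_eq W)
  have fst: "distr (measure_pmf W) borel fst = distr P borel e"
  proof (rule finite_support_measure_eqI[OF _ _ _ _ G])
    show "finite_measure (distr (measure_pmf W) borel fst)"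
      by (intro prob_space.finite_measure measure_pmf.prob_space_distr) simp
    show "AE x in distr (measure_pmf W) borel fst. x \<in> G"
      using sub Gm[of G] by (subst AE_distr_iff) (auto simp: AE_measure_pmf_iff)
    show "AE x in distr P borel e. x \<in> G"
      using AE_P Gm[of G] by (subst AE_distr_iff) auto
    show "measure (distr (measure_pmf W) borel fst) {a} = measure (distr P borel e) {a}" if "a \<in> G" for a
    proof -
      have "measure (distr (measure_pmf W) borel fst) {a} = pmf (map_pmf fst W) a"
        by (simp add: measure_distr pmf_map)
      also have "\<dots> = (\<Sum>c\<in>{c\<in>G \<times> G. fst c = a}. w (fst c) (snd c))"
        using G sub by (simp add: pmf_map_finite[of "G \<times> G"] W)
      also have "{c\<in>G \<times> G. fst c = a} = Pair a ` G" using that by auto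
      also have "(\<Sum>c\<in>Pair a ` G. w (fst c) (snd c)) = (\<Sum>j\<in>G. w a j)"
        by (subst sum.reindex) (auto simp: inj_on_def)
      finally show ?thesis using w(3)[OF that] by (simp add: p_def)
    qed
  qed (auto intro: Pe.finite_measure_axioms)
  have snd: "distr (measure_pmf W) borel snd = distr Q borel e"
  proof (rule finite_support_measure_eqI[OF _ _ _ _ G])
    show "finite_measure (distr (measure_pmf W) borel snd)"
      by (intro prob_space.finite_measure measure_pmf.prob_space_distr) simp
    show "AE x in distr (measure_pmf W) borel snd. x \<in> G"
      using sub Gm[of G] by (subst AE_distr_iff) (auto simp: AE_measure_pmf_iff)
    show "AE x in distr Q borel e. x \<in> G"
      using AE_Q Gm[of G] by (subst AE_distr_iff) auto
    show "measure (distr (measure_pmf W) borel snd) {a} = measure (distr Q borel e) {a}" if "a \<in> G" for a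
    proof -
      have "measure (distr (measure_pmf W) borel snd) {a} = pmf (map_pmf snd W) a"
        by (simp add: measure_distr pmf_map)
      also have "\<dots> = (\<Sum>c\<in>{c\<in>G \<times> G. snd c = a}. w (fst c) (snd c))"
        using G sub by (simp add: pmf_map_finite[of "G \<times> G"] W)
      also have "{c\<in>G \<times> G. snd c = a} = (\<lambda>i. (i, a)) ` G" using that by auto
      also have "(\<Sum>c\<in>(\<lambda>i. (i, a)) ` G. w (fst c) (snd c)) = (\<Sum>i\<in>G. w i a)"
        by (subst sum.reindex) (auto simp: inj_on_def)
      finally show ?thesis using w(4)[OF that] by (simp add: q_def)
    qed
  qed (auto intro: Qe.finite_measure_axioms)
  show ?thesis
    by (rule that[of W]) (use sub w(2) fst snd in \<open>auto simp: set_pmf_eq W G_def\<close>)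
qed

section \<open>Strassen's theorem on a box\<close>

text \<open>The index type may be uncountable, so no diagonal subsequence is extracted. A cluster
  point in the compact product yields a filter finer than \<open>sequentially\<close> along which
  all coordinates converge at once.\<close>

lemma pointwise_limit_filter:
  fixes f :: "nat \<Rightarrow> 'i \<Rightarrow> real"
  assumes "\<And>n i. f n i \<in> {a..b}"
  obtains F l where "F \<noteq> bot" "F \<le> sequentially" "\<And>i. ((\<lambda>n. f n i) \<longlongrightarrow> l i) F"
proof -
  have "compact (PiE UNIV (\<lambda>_::'i. {a..b}))"
    by (rule compact_PiE_UNIV) simp
  moreover have "filtermap f sequentially \<noteq> bot"
    by (simp add: filtermap_bot_iff)
  moreover have "eventually (\<lambda>y. y \<in> PiE UNIV (\<lambda>_. {a..b})) (filtermap f sequentially)"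
    using assms by (auto simp: eventually_filtermap intro!: always_eventually)
  ultimately obtain l where l: "inf (nhds l) (filtermap f sequentially) \<noteq> bot"
    unfolding compact_filter by blast
  \<comment> \<open>\<open>F\<close> adds to \<open>sequentially\<close> the requirement that
    \<open>f n\<close> be near \<open>l\<close>; it is proper because \<open>l\<close> is a cluster
    point.\<close>
  define F where "F = inf sequentially (filtercomap f (nhds l))"
  have "F \<noteq> bot"
  proof
    assume "F = bot"
    then have "eventually (\<lambda>_. False) F" by simp
    then obtain A B where A: "eventually A sequentially" and B: "eventually B (filtercomap f (nhds l))"
      and AB: "\<And>n. A n \<Longrightarrow> B n \<Longrightarrow> False"
      unfolding F_def eventually_inf by blast
    from B obtain C where C: "eventually C (nhds l)" "\<And>n. C (f n) \<Longrightarrow> B n"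
      unfolding eventually_filtercomap by blast
    have "eventually (\<lambda>y. \<not> C y) (filtermap f sequentially)"
      unfolding eventually_filtermap using A by eventually_elim (use C AB in blast)
    with C(1) have "eventually (\<lambda>_. False) (inf (nhds l) (filtermap f sequentially))"
      unfolding eventually_inf by blast
    with l show False by (simp add: trivial_limit_def)
  qed
  moreover have "F \<le> sequentially" by (simp add: F_def)
  moreover have "((\<lambda>n. f n i) \<longlongrightarrow> l i) F" for i
  proof -
    have "filterlim f (nhds l) F"
      unfolding F_def by (rule filterlim_mono[OF filterlim_filtercomap[of f "nhds l"]]) auto
    moreover have "open ((\<lambda>y::'i \<Rightarrow> real. y i) -` S)" if "open S" for S
      using that continuous_on_product_coordinates[of i] by (rule open_vimage)
    ultimately show ?thesis
      by (intro topological_tendstoI) (force dest: topological_tendstoD)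
  qed
  ultimately show ?thesis by (rule that)
qed

lemma tendsto_eucl_le:
  fixes a b :: "'a::ordered_euclidean_space"
  assumes "X \<longlonglongrightarrow> a" "Y \<longlonglongrightarrow> b" "\<And>n. X n \<le> Y n"
  shows "a \<le> b"
  unfolding eucl_le[where 'a='a]
proof
  fix i :: 'a assume "i \<in> Basis"
  then have "X n \<bullet> i \<le> Y n \<bullet> i" for n
    using assms(3)[of n] by (auto simp: eucl_le[where 'a='a])
  then show "a \<bullet> i \<le> b \<bullet> i"
    using assms(1,2) by (intro LIMSEQ_le[of "\<lambda>n. X n \<bullet> i" _ "\<lambda>n. Y n \<bullet> i"] tendsto_intros) auto
qed

text \<open>Every term after \<open>N\<close> rounds to the same point \<open>a N\<close>, hence
  lies within the level-\<open>N\<close> rounding error of it.\<close>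

lemma Cauchy_grid_up_consistent:
  fixes a :: "nat \<Rightarrow> 'a::ordered_euclidean_space"
  assumes "\<And>m n. m \<le> n \<Longrightarrow> a m = grid_up m (a n)"
  shows "Cauchy a"
proof (rule metric_CauchyI)
  fix r :: real assume "r > 0"
  have "(\<lambda>n. DIM('a) / 2 ^ n) \<longlonglongrightarrow> (0::real)"
    by (rule LIMSEQ_divide_realpow_zero) simp
  then have "eventually (\<lambda>n. real DIM('a) / 2 ^ n < r / 2) sequentially"
    using \<open>r > 0\<close> by (auto dest: order_tendstoD(2)[of _ _ _ "r / 2"])
  then obtain N where N: "real DIM('a) / 2 ^ N < r / 2"
    by (auto simp: eventually_sequentially)
  have "dist (a m) (a n) < r" if "m \<ge> N" "n \<ge> N" for m n
  proof -
    have "dist (a N) (a k) < r / 2" if "k \<ge> N" for k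
      using dist_grid_up[of N "a k"] N unfolding assms[OF that] by linarith
    from this[OF that(1)] this[OF that(2)] show ?thesis
      using dist_triangle_half_l by (metis dist_commute)
  qed
  then show "\<exists>M. \<forall>m\<ge>M. \<forall>n\<ge>M. dist (a m) (a n) < r" by blast
qed

text \<open>The finite couplings of the grid projections have, by compactness of a product of intervals,
  a limit that is consistent in the grid level; the projective limit of these finite laws lives on
  sequences of grid points, and the limit of such a sequence recovers the pair.\<close>

theorem strassen_box:
  fixes P Q :: "'a::ordered_euclidean_space measure"
  assumes P: "prob_space P" "sets P = sets borel" "AE x in P. x \<in> {xl..xu}"
    and Q: "prob_space Q" "sets Q = sets borel" "AE x in Q. x \<in> {xl..xu}"
    and fosd: "fosd P Q"
  obtains \<kappa> where "\<kappa> \<in> couplings P Q" "AE p in \<kappa>. fst p \<le> snd p"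
proof -
  interpret P: prob_space P by fact
  interpret Q: prob_space Q by fact
  have [measurable_cong]: "sets P = sets borel" "sets Q = sets borel" by fact+
  have proj[measurable]: "fst \<in> borel_measurable (borel :: ('a \<times> 'a) measure)"
      "snd \<in> borel_measurable (borel :: ('a \<times> 'a) measure)"
    by (simp_all flip: borel_prod)
  define E :: "nat \<Rightarrow> 'a \<times> 'a \<Rightarrow> 'a \<times> 'a" where "E n = map_prod (grid_up n) (grid_up n)" for n
  define C :: "nat \<Rightarrow> ('a \<times> 'a) set" where "C n = grid_up n ` {xl..xu} \<times> grid_up n ` {xl..xu}" for n
  have EE: "E m (E n c) = E m c" if "m \<le> n" for m n c
    using that by (cases c) (simp add: E_def grid_up_grid_up)
  have EC: "E m c \<in> C m" if "c \<in> C n" "m \<le> n" for m n c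
    using that by (auto simp: C_def E_def grid_up_grid_up)
  have finC: "finite (C n)" for n by (simp add: C_def finite_grid_up)
  have "\<exists>W::('a \<times> 'a) pmf. set_pmf W \<subseteq> C n \<and> (\<forall>c\<in>set_pmf W. fst c \<le> snd c) \<and>
      distr (measure_pmf W) borel fst = distr P borel (grid_up n) \<and>
      distr (measure_pmf W) borel snd = distr Q borel (grid_up n)" for n
    by (rule fosd_discrete_coupling[OF P Q fosd measurable_grid_up grid_up_mono grid_up_ge
          grid_up_grid_up[OF order_refl] finite_grid_up, of n]) (auto simp: C_def)
  then obtain W :: "nat \<Rightarrow> ('a \<times> 'a) pmf" where
    WC: "\<And>n. set_pmf (W n) \<subseteq> C n" and
    Wle: "\<And>n c. c \<in> set_pmf (W n) \<Longrightarrow> fst c \<le> snd c" and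
    WP: "\<And>n. distr (measure_pmf (W n)) borel fst = distr P borel (grid_up n)" and
    WQ: "\<And>n. distr (measure_pmf (W n)) borel snd = distr Q borel (grid_up n)"
    by metis
  \<comment> \<open>The finite couplings \<open>W n\<close> of different levels need not be
    consistent. \<open>f n (m, c)\<close> is the mass that \<open>W n\<close> gives to
    \<open>c\<close> after coarsening to level \<open>m\<close>; consistency appears in the limit
    along \<open>F\<close>.\<close>
  define f where "f n i = pmf (map_pmf (E (fst i)) (W n)) (snd i)" for n and i :: "nat \<times> 'a \<times> 'a"
  have "f n i \<in> {0..1}" for n i by (simp add: f_def pmf_le_1)
  then obtain F l where F: "F \<noteq> bot" "F \<le> sequentially" and l: "\<And>i. ((\<lambda>n. f n i) \<longlongrightarrow> l i) F"
    using pointwise_limit_filter[of f 0 1] by blast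
  have ev: "eventually (\<lambda>n. m \<le> n) F" for m
    using F(2) eventually_ge_at_top[of m] by (rule filter_leD)
  have mapC: "set_pmf (map_pmf (E m) (W n)) \<subseteq> C m" if "m \<le> n" for m n
    using WC[of n] EC[OF _ that] by auto
  have lim_eq: "l i = r" if "eventually (\<lambda>n. f n i = r) F" for i r
    using tendsto_unique[OF F(1) l tendsto_eventually[OF that]] .
  have "\<exists>p. \<forall>c. pmf p c = l (m, c)" for m
  proof -
    have "l (m, c) = 0" if "c \<notin> C m" for c
    proof (rule lim_eq)
      show "eventually (\<lambda>n. f n (m, c) = 0) F"
        using ev[of m] by eventually_elim (use mapC that in \<open>auto simp: f_def pmf_eq_0_set_pmf\<close>)
    qed
    moreover have "0 \<le> l (m, c)" for c
      by (rule tendsto_lowerbound[OF l _ F(1)]) (simp add: f_def)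
    \<comment> \<open>For \<open>n \<ge> m\<close> the coarsened laws all live on the finite set
      \<open>C m\<close>, so no mass escapes in the limit.\<close>
    moreover have "((\<lambda>n. \<Sum>c\<in>C m. f n (m, c)) \<longlongrightarrow> (\<Sum>c\<in>C m. l (m, c))) F"
      by (intro tendsto_sum l)
    then have "(\<Sum>c\<in>C m. l (m, c)) = 1"
    proof (rule tendsto_unique[OF F(1)])
      show "((\<lambda>n. \<Sum>c\<in>C m. f n (m, c)) \<longlongrightarrow> 1) F"
      proof (rule tendsto_eventually)
        show "eventually (\<lambda>n. (\<Sum>c\<in>C m. f n (m, c)) = 1) F"
          using ev[of m] by eventually_elim (simp add: f_def sum_pmf_eq_1[OF finC mapC])
      qed
    qed
    ultimately show ?thesis
      using finC[of m] by (metis (no_types, lifting) pmf_of_finite_weights[of "C m" "\<lambda>c. l (m, c)"])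
  qed
  then obtain p where p: "\<And>m c. pmf (p m) c = l (m, c)" by metis
  have pC: "set_pmf (p m) \<subseteq> C m" for m
  proof
    fix c assume "c \<in> set_pmf (p m)"
    show "c \<in> C m"
    proof (rule ccontr)
      assume "c \<notin> C m"
      have "l (m, c) = 0"
        by (rule lim_eq)
           (use ev[of m] in \<open>eventually_elim, use mapC \<open>c \<notin> C m\<close> in \<open>auto simp: f_def pmf_eq_0_set_pmf\<close>\<close>)
      with \<open>c \<in> set_pmf (p m)\<close> show False by (simp add: set_pmf_eq p)
    qed
  qed
  \<comment> \<open>Image masses are finite sums of point masses, so they pass to the limit. The
    free map \<open>g\<close> covers both coarsening and the two projections.\<close>
  have lim_map: "((\<lambda>n. pmf (map_pmf (g \<circ> E m) (W n)) a) \<longlongrightarrow> pmf (map_pmf g (p m)) a) F" for g :: "'a \<times> 'a \<Rightarrow> 'b" and m a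
  proof -
    have "((\<lambda>n. \<Sum>c\<in>{c\<in>C m. g c = a}. f n (m, c)) \<longlongrightarrow> (\<Sum>c\<in>{c\<in>C m. g c = a}. l (m, c))) F"
      by (intro tendsto_sum l)
    also have "(\<Sum>c\<in>{c\<in>C m. g c = a}. l (m, c)) = pmf (map_pmf g (p m)) a"
      using finC pC by (simp add: pmf_map_finite[of "C m"] p)
    finally show ?thesis
    proof (rule Lim_transform_eventually)
      show "eventually (\<lambda>n. (\<Sum>c\<in>{c\<in>C m. g c = a}. f n (m, c)) = pmf (map_pmf (g \<circ> E m) (W n)) a) F"
        using ev[of m]
      proof eventually_elim
        case (elim n)
        show ?case
          using pmf_map_finite[OF finC mapC[OF elim], of g a]
          by (simp add: f_def map_pmf_comp comp_def)
      qed
    qed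
  qed
  \<comment> \<open>Coarsening via level \<open>k\<close> is coarsening directly to
    \<open>m\<close>, so both point masses are limits of the same family.\<close>
  have cons: "map_pmf (E m) (p k) = p m" if "m \<le> k" for m k
  proof (rule pmf_eqI)
    fix c
    have "E m \<circ> E k = E m" using EE[OF that] by auto
    then have "((\<lambda>n. f n (m, c)) \<longlongrightarrow> pmf (map_pmf (E m) (p k)) c) F"
      using lim_map[of "E m" k c] by (simp add: f_def)
    then show "pmf (map_pmf (E m) (p k)) c = pmf (p m) c"
      unfolding p using tendsto_unique[OF F(1) _ l] by blast
  qed
  have ple: "fst c \<le> snd c" if "c \<in> set_pmf (p m)" for c m
  proof (rule ccontr)
    assume "\<not> fst c \<le> snd c"
    \<comment> \<open>Rounding is monotone, so coarsened ordered pairs stay ordered and an unordered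
      \<open>c\<close> never gets mass.\<close>
    have "f n (m, c) = 0" for n
      using Wle[of _ n] \<open>\<not> fst c \<le> snd c\<close>
      by (auto simp: f_def pmf_eq_0_set_pmf E_def intro!: grid_up_mono)
    then have "l (m, c) = 0" by (intro lim_eq) simp
    with that show False by (simp add: set_pmf_eq p)
  qed
  \<comment> \<open>Stated for a general \<open>\<pi>\<close> to treat both marginals at once. For
    \<open>n \<ge> m\<close> the level-\<open>m\<close> marginal of \<open>W n\<close> is already
    the rounded \<open>R\<close>, so the limit is that of an eventually constant family.\<close>
  have marg: "distr (measure_pmf (p m)) borel \<pi> = distr R borel (grid_up m)"
    if R: "prob_space R" "sets R = sets borel" "AE x in R. x \<in> {xl..xu}"
      and W: "\<And>n. distr (measure_pmf (W n)) borel \<pi> = distr R borel (grid_up n)"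
      and comm: "\<And>n c. \<pi> (E n c) = grid_up n (\<pi> c)" and pi: "\<pi> ` C m \<subseteq> grid_up m ` {xl..xu}"
    for R and \<pi> :: "'a \<times> 'a \<Rightarrow> 'a" and m
  proof -
    interpret R: prob_space R by fact
    note [measurable_cong] = R(2)
    show ?thesis
    proof (rule finite_support_measure_eqI[OF _ _ _ _ finite_grid_up])
      show "finite_measure (distr (measure_pmf (p m)) borel \<pi>)"
        by (intro prob_space.finite_measure measure_pmf.prob_space_distr) simp
      show "finite_measure (distr R borel (grid_up m))"
        by (intro prob_space.finite_measure R.prob_space_distr) simp
      have G: "grid_up m ` {xl..xu} \<in> sets borel"
        by (intro borel_closed finite_imp_closed finite_grid_up)
      show "AE x in distr (measure_pmf (p m)) borel \<pi>. x \<in> grid_up m ` {xl..xu}"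
        using pi pC[of m] G by (subst AE_distr_iff) (auto simp: AE_measure_pmf_iff)
      show "AE x in distr R borel (grid_up m). x \<in> grid_up m ` {xl..xu}"
        using R(3) G by (subst AE_distr_iff) auto
      fix a
      have "((\<lambda>n. pmf (map_pmf (\<pi> \<circ> E m) (W n)) a) \<longlongrightarrow> measure (distr R borel (grid_up m)) {a}) F"
      proof (rule tendsto_eventually)
        show "eventually (\<lambda>n. pmf (map_pmf (\<pi> \<circ> E m) (W n)) a = measure (distr R borel (grid_up m)) {a}) F"
          using ev[of m]
        proof eventually_elim
          case (elim n)
          have "pmf (map_pmf (\<pi> \<circ> E m) (W n)) a = measure (distr (W n) borel (grid_up m \<circ> \<pi>)) {a}"
            by (simp add: measure_distr pmf_map comp_def comm)
          also have "distr (W n) borel (grid_up m \<circ> \<pi>) = distr (distr (W n) borel \<pi>) borel (grid_up m)"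
            by (subst distr_distr) auto
          also have "\<dots> = distr R borel (grid_up m)"
            unfolding W using elim by (subst distr_distr) (auto simp: comp_def grid_up_grid_up)
          finally show ?case .
        qed
      qed
      then have "pmf (map_pmf \<pi> (p m)) a = measure (distr R borel (grid_up m)) {a}"
        by (rule tendsto_unique[OF F(1) lim_map])
      then show "measure (distr (measure_pmf (p m)) borel \<pi>) {a} = measure (distr R borel (grid_up m)) {a}"
        by (simp add: measure_distr pmf_map)
    qed auto
  qed
  \<comment> \<open>The sum of \<open>J\<close> is a level at least as fine as every
    \<open>j \<in> J\<close>, and it is defined for empty \<open>J\<close> too. The joint law over
    \<open>J\<close> coarsens one pair drawn at that level.\<close>
  define L where "L J = distr (measure_pmf (p (\<Sum>J))) (PiM J (\<lambda>_. borel)) (\<lambda>c. \<lambda>j\<in>J. E j c)" for J :: "nat set"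
  have le_sum: "j \<le> \<Sum>J" if "finite J" "j \<in> J" for j :: nat and J
    using member_le_sum[OF that(2), of "\<lambda>x. x"] that by simp
  have res_meas: "(\<lambda>c. \<lambda>j\<in>J. E j c) \<in> measurable (measure_pmf q) (PiM J (\<lambda>_. borel))" for q and J
    by (simp add: space_PiM)
  \<comment> \<open>Kolmogorov extension; its compatibility condition is \<open>cons\<close>,
    applied at the levels \<open>\<Sum>J \<le> \<Sum>H\<close>.\<close>
  interpret L: polish_projective UNIV L
  proof (rule polish_projective.intro, rule projective_family.intro)
    fix J :: "nat set" assume "finite J" "J \<subseteq> UNIV"
    then show "prob_space (L J)"
      unfolding L_def by (intro measure_pmf.prob_space_distr res_meas)
  next
    fix J H :: "nat set" assume JH: "J \<subseteq> H" "finite H" "H \<subseteq> UNIV"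
    then have finJ: "finite J" by (auto intro: finite_subset)
    have "\<Sum>J \<le> \<Sum>H" using JH by (intro sum_mono2) auto
    have "distr (L H) (PiM J (\<lambda>_. borel)) (\<lambda>f. restrict f J) =
        distr (measure_pmf (p (\<Sum>H))) (PiM J (\<lambda>_. borel)) ((\<lambda>f. restrict f J) \<circ> (\<lambda>c. \<lambda>j\<in>H. E j c))"
      unfolding L_def by (rule distr_distr[OF measurable_restrict_subset[OF JH(1)] res_meas])
    \<comment> \<open>Each \<open>j \<in> J\<close> is at most the sum of \<open>J\<close>, so
      coarsening to \<open>j\<close> factors through that level.\<close>
    also have "(\<lambda>f. restrict f J) \<circ> (\<lambda>c. \<lambda>j\<in>H. E j c) = (\<lambda>c. \<lambda>j\<in>J. E j c) \<circ> E (\<Sum>J)"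
      using JH(1) le_sum[OF finJ] EE by (auto simp: fun_eq_iff restrict_def)
    also have "distr (measure_pmf (p (\<Sum>H))) (PiM J (\<lambda>_. borel)) \<dots> =
        distr (distr (measure_pmf (p (\<Sum>H))) (count_space UNIV) (E (\<Sum>J))) (PiM J (\<lambda>_. borel)) (\<lambda>c. \<lambda>j\<in>J. E j c)"
      by (rule distr_distr[symmetric]) (auto simp: space_PiM)
    also have "\<dots> = L J"
      using cons[OF \<open>\<Sum>J \<le> \<Sum>H\<close>] by (simp add: L_def flip: map_pmf_rep_eq)
    finally show "L J = distr (L H) (PiM J (\<lambda>_. borel)) (\<lambda>f. restrict f J)" ..
  qed
  let ?\<mu> = "L.lim"
  have meas_restr: "(\<lambda>\<omega>. restrict \<omega> J) \<in> measurable ?\<mu> (PiM J (\<lambda>_. borel))" for J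
    by (simp add: measurable_cong_sets[OF L.sets_lim refl] measurable_restrict_subset)
  have restr: "distr ?\<mu> (PiM J (\<lambda>_. borel)) (\<lambda>\<omega>. restrict \<omega> J) = L J" if "finite J" for J
  proof (rule measure_eqI)
    show "sets (distr ?\<mu> (PiM J (\<lambda>_. borel)) (\<lambda>\<omega>. restrict \<omega> J)) = sets (L J)"
      by (simp add: L_def)
    fix X assume "X \<in> sets (distr ?\<mu> (PiM J (\<lambda>_. borel)) (\<lambda>\<omega>. restrict \<omega> J))"
    then have X: "X \<in> sets (PiM J (\<lambda>_. borel :: ('a \<times> 'a) measure))" by simp
    show "emeasure (distr ?\<mu> (PiM J (\<lambda>_. borel)) (\<lambda>\<omega>. restrict \<omega> J)) X = emeasure (L J) X"
      using L.emeasure_lim_emb[OF subset_UNIV that X] X meas_restr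
      by (simp add: emeasure_distr prod_emb_def space_PiM)
  qed
  have comp[measurable]: "(\<lambda>\<omega>. \<omega> n) \<in> borel_measurable ?\<mu>" for n
    by (simp add: measurable_cong_sets[OF L.sets_lim refl])
  have AE_le: "AE \<omega> in ?\<mu>. \<forall>n. fst (\<omega> n) \<le> snd (\<omega> n)"
  proof (subst AE_all_countable, rule allI)
    fix n
    have "AE \<omega> in L {n}. fst (\<omega> n) \<le> snd (\<omega> n)"
      unfolding L_def
    proof (subst AE_distr_iff[OF res_meas])
      show "{\<omega> \<in> space (PiM {n} (\<lambda>_. borel)). fst (\<omega> n) \<le> snd (\<omega> n)} \<in> sets (PiM {n} (\<lambda>_. borel :: ('a\<times>'a) measure))"
        unfolding eucl_le[where 'a='a] by measurable
      show "AE c in measure_pmf (p (\<Sum>{n})). fst ((\<lambda>j\<in>{n}. E j c) n) \<le> snd ((\<lambda>j\<in>{n}. E j c) n)"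
        using ple by (auto simp: AE_measure_pmf_iff E_def intro!: grid_up_mono)
    qed
    then have "AE \<omega> in distr ?\<mu> (PiM {n} (\<lambda>_. borel)) (\<lambda>\<omega>. restrict \<omega> {n}). fst (\<omega> n) \<le> snd (\<omega> n)"
      by (subst restr) simp_all
    from AE_distrD[OF meas_restr this] show "AE \<omega> in ?\<mu>. fst (\<omega> n) \<le> snd (\<omega> n)" by simp
  qed
  \<comment> \<open>There are countably many pairs of levels, and each relation is decided by a
    two-level marginal, where it holds by construction.\<close>
  have AE_cons: "AE \<omega> in ?\<mu>. \<forall>m n. m \<le> n \<longrightarrow> \<omega> m = E m (\<omega> n)"
  proof (subst AE_all_countable, rule allI, subst AE_all_countable, rule allI)
    fix m n :: nat
    show "AE \<omega> in ?\<mu>. m \<le> n \<longrightarrow> \<omega> m = E m (\<omega> n)"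
    proof (cases "m \<le> n")
      case True
      have [measurable]: "E m \<in> measurable borel borel"
        unfolding E_def map_prod_def case_prod_beta by measurable
      have "AE \<omega> in L {m, n}. \<omega> m = E m (\<omega> n)"
        unfolding L_def
      proof (subst AE_distr_iff[OF res_meas])
        show "{\<omega> \<in> space (PiM {m, n} (\<lambda>_. borel)). \<omega> m = E m (\<omega> n)} \<in> sets (PiM {m, n} (\<lambda>_. borel :: ('a\<times>'a) measure))"
          by measurable
        show "AE c in measure_pmf (p (\<Sum>{m, n})). (\<lambda>j\<in>{m, n}. E j c) m = E m ((\<lambda>j\<in>{m, n}. E j c) n)"
          using EE[OF True] by (simp add: AE_measure_pmf_iff)
      qed
      then have "AE \<omega> in distr ?\<mu> (PiM {m, n} (\<lambda>_. borel)) (\<lambda>\<omega>. restrict \<omega> {m, n}). \<omega> m = E m (\<omega> n)"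
        by (subst restr) simp_all
      from AE_distrD[OF meas_restr this] show ?thesis by simp
    qed simp
  qed
  \<comment> \<open>The sequence of projected grid points has the same law as the successive
    roundings of one draw from \<open>R\<close>, checked on finite-dimensional cylinders. The
    roundings converge to the draw, so the measurable map \<open>lim\<close> carries this common law
    to \<open>R\<close>.\<close>
  have lim_law: "distr ?\<mu> borel (\<lambda>\<omega>. lim (\<lambda>n. \<pi> (\<omega> n))) = R"
    if R: "prob_space R" "sets R = sets borel" "AE x in R. x \<in> {xl..xu}"
      and W: "\<And>n. distr (measure_pmf (W n)) borel \<pi> = distr R borel (grid_up n)"
      and comm: "\<And>n c. \<pi> (E n c) = grid_up n (\<pi> c)" and pi: "\<And>m. \<pi> ` C m \<subseteq> grid_up m ` {xl..xu}"
      and [measurable]: "\<pi> \<in> borel_measurable borel"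
    for R and \<pi> :: "'a \<times> 'a \<Rightarrow> 'a"
  proof -
    interpret R: prob_space R by fact
    note [measurable_cong] = R(2)
    let ?S = "PiM UNIV (\<lambda>_::nat. borel :: 'a measure)"
    have m1: "(\<lambda>\<omega> n. \<pi> (\<omega> n)) \<in> measurable ?\<mu> ?S"
      by (rule measurable_PiM_single') auto
    have m2: "(\<lambda>x n. grid_up n x) \<in> measurable R ?S"
      by (rule measurable_PiM_single') auto
    have seq: "distr ?\<mu> ?S (\<lambda>\<omega> n. \<pi> (\<omega> n)) = distr R ?S (\<lambda>x n. grid_up n x)"
    proof (rule measure_eqI_PiM_infinite)
      show "finite_measure (distr ?\<mu> ?S (\<lambda>\<omega> n. \<pi> (\<omega> n)))"
        by (intro prob_space.finite_measure L.P.prob_space_distr m1)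
      fix A :: "nat \<Rightarrow> 'a set" and J :: "nat set"
      assume J: "finite J" and A: "\<And>i. i \<in> J \<Longrightarrow> A i \<in> sets borel"
      let ?X = "prod_emb UNIV (\<lambda>_. borel) J (PiE J A)"
      have X: "?X \<in> sets ?S" using J A by (intro sets_PiM_I) auto
      have "emeasure (distr ?\<mu> ?S (\<lambda>\<omega> n. \<pi> (\<omega> n))) ?X = emeasure ?\<mu> {\<omega>\<in>space ?\<mu>. \<forall>j\<in>J. \<pi> (\<omega> j) \<in> A j}"
        using X by (auto simp: emeasure_distr[OF m1] prod_emb_def space_PiM PiE_iff intro!: arg_cong[where f="emeasure ?\<mu>"])
      also have "\<dots> = emeasure (distr ?\<mu> (PiM J (\<lambda>_. borel)) (\<lambda>\<omega>. restrict \<omega> J))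
          {\<omega>\<in>space (PiM J (\<lambda>_. borel)). \<forall>j\<in>J. \<pi> (\<omega> j) \<in> A j}"
      proof (subst emeasure_distr[OF meas_restr])
        show "{\<omega>\<in>space (PiM J (\<lambda>_. borel)). \<forall>j\<in>J. \<pi> (\<omega> j) \<in> A j} \<in> sets (PiM J (\<lambda>_. borel))"
          using J A by measurable
      qed (auto simp: space_PiM intro!: arg_cong[where f="emeasure ?\<mu>"])
      also have "\<dots> = emeasure (measure_pmf (p (\<Sum>J))) {c. \<forall>j\<in>J. \<pi> (E j c) \<in> A j}"
        unfolding restr[OF J] unfolding L_def
      proof (subst emeasure_distr[OF res_meas])
        show "{\<omega>\<in>space (PiM J (\<lambda>_. borel)). \<forall>j\<in>J. \<pi> (\<omega> j) \<in> A j} \<in> sets (PiM J (\<lambda>_. borel))"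
          using J A by measurable
      qed (auto simp: space_PiM intro!: arg_cong[where f="emeasure (measure_pmf (p (\<Sum>J)))"])
      also have "\<dots> = emeasure (distr (measure_pmf (p (\<Sum>J))) borel \<pi>) {x. \<forall>j\<in>J. grid_up j x \<in> A j}"
        using J A by (subst emeasure_distr) (auto simp: comm vimage_def)
      also have "\<dots> = emeasure (distr R borel (grid_up (\<Sum>J))) {x. \<forall>j\<in>J. grid_up j x \<in> A j}"
        by (simp add: marg[OF R W comm pi])
      also have "\<dots> = emeasure R {x\<in>space R. \<forall>j\<in>J. grid_up j x \<in> A j}"
        using J A le_sum[OF J] sets_eq_imp_space_eq[OF R(2)]
        by (subst emeasure_distr) (auto simp: grid_up_grid_up intro!: arg_cong[where f="emeasure R"])
      also have "\<dots> = emeasure (distr R ?S (\<lambda>x n. grid_up n x)) ?X"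
        using X by (auto simp: emeasure_distr[OF m2] prod_emb_def space_PiM PiE_iff intro!: arg_cong[where f="emeasure R"])
      finally show "emeasure (distr ?\<mu> ?S (\<lambda>\<omega> n. \<pi> (\<omega> n))) ?X = emeasure (distr R ?S (\<lambda>x n. grid_up n x)) ?X" .
    qed auto
    have mlim: "(\<lambda>s. lim s) \<in> measurable ?S borel"
      by (rule borel_measurable_lim_metric[of "\<lambda>n s. s n"]) auto
    have "distr ?\<mu> borel (\<lambda>\<omega>. lim (\<lambda>n. \<pi> (\<omega> n))) = distr (distr ?\<mu> ?S (\<lambda>\<omega> n. \<pi> (\<omega> n))) borel lim"
      by (subst distr_distr[OF mlim m1]) (simp add: comp_def)
    also have "\<dots> = distr R borel (\<lambda>x. x)"
      unfolding seq by (subst distr_distr[OF mlim m2]) (simp add: comp_def limI[OF grid_up_tendsto])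
    also have "\<dots> = R"
      using distr_id2[OF R(2)[symmetric]] by (simp add: id_def)
    finally show ?thesis .
  qed
  have m_lim[measurable]: "(\<lambda>\<omega>. lim (\<lambda>n. fst (\<omega> n))) \<in> borel_measurable ?\<mu>"
      "(\<lambda>\<omega>. lim (\<lambda>n. snd (\<omega> n))) \<in> borel_measurable ?\<mu>"
    by measurable
  define \<kappa> where "\<kappa> = distr ?\<mu> (P \<Otimes>\<^sub>M Q) (\<lambda>\<omega>. (lim (\<lambda>n. fst (\<omega> n)), lim (\<lambda>n. snd (\<omega> n))))"
  have mk: "(\<lambda>\<omega>. (lim (\<lambda>n. fst (\<omega> n)), lim (\<lambda>n. snd (\<omega> n)))) \<in> measurable ?\<mu> (P \<Otimes>\<^sub>M Q)"
    by measurable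
  have "distr \<kappa> P fst = distr ?\<mu> borel (\<lambda>\<omega>. lim (\<lambda>n. fst (\<omega> n)))"
    unfolding \<kappa>_def by (subst distr_distr[OF _ mk]) (auto simp: comp_def P(2) cong: distr_cong)
  also have "\<dots> = P"
    by (rule lim_law[OF P WP]) (use proj in \<open>auto simp: E_def C_def\<close>)
  finally have k1: "distr \<kappa> P fst = P" .
  have "distr \<kappa> Q snd = distr ?\<mu> borel (\<lambda>\<omega>. lim (\<lambda>n. snd (\<omega> n)))"
    unfolding \<kappa>_def by (subst distr_distr[OF _ mk]) (auto simp: comp_def Q(2) cong: distr_cong)
  also have "\<dots> = Q"
    by (rule lim_law[OF Q WQ]) (use proj in \<open>auto simp: E_def C_def\<close>)
  finally have k2: "distr \<kappa> Q snd = Q" .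
  have "prob_space \<kappa>" unfolding \<kappa>_def by (rule L.P.prob_space_distr[OF mk])
  then have "\<kappa> \<in> couplings P Q"
    using k1 k2 by (simp add: couplings_def \<kappa>_def)
  moreover have "AE p in \<kappa>. fst p \<le> snd p"
    unfolding \<kappa>_def
  proof (subst AE_distr_iff[OF mk])
    show "{p \<in> space (P \<Otimes>\<^sub>M Q). fst p \<le> snd p} \<in> sets (P \<Otimes>\<^sub>M Q)"
      unfolding eucl_le[where 'a='a] by measurable
    show "AE \<omega> in ?\<mu>. fst (lim (\<lambda>n. fst (\<omega> n)), lim (\<lambda>n. snd (\<omega> n))) \<le> snd (lim (\<lambda>n. fst (\<omega> n)), lim (\<lambda>n. snd (\<omega> n)))"
      using AE_le AE_cons
    proof eventually_elim
      case (elim \<omega>)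
      \<comment> \<open>Consistency makes both coordinate sequences converge, and the closed order
        survives the limit.\<close>
      have "Cauchy (\<lambda>n. fst (\<omega> n))" "Cauchy (\<lambda>n. snd (\<omega> n))"
        using elim(2) by (auto intro!: Cauchy_grid_up_consistent simp: E_def)
      then have "(\<lambda>n. fst (\<omega> n)) \<longlonglongrightarrow> lim (\<lambda>n. fst (\<omega> n))" "(\<lambda>n. snd (\<omega> n)) \<longlonglongrightarrow> lim (\<lambda>n. snd (\<omega> n))"
        by (auto simp: Cauchy_convergent_iff convergent_LIMSEQ_iff)
      then show ?case using elim(1) by (auto intro: tendsto_eucl_le)
    qed
  qed
  ultimately show ?thesis by (rule that)
qed

section \<open>Lower-orthant CSD in terms of gap and gain\<close>

lemma couplingsD:
  assumes "\<kappa> \<in> couplings P Q" "sets P = sets borel" "sets Q = sets borel"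
  shows "prob_space \<kappa>" "sets \<kappa> = sets (borel \<Otimes>\<^sub>M borel)" "space \<kappa> = UNIV"
    "distr \<kappa> borel fst = P" "distr \<kappa> borel snd = Q"
proof -
  show "prob_space \<kappa>" using assms(1) by (simp add: couplings_def)
  show sets: "sets \<kappa> = sets (borel \<Otimes>\<^sub>M borel)"
    using assms by (simp add: couplings_def cong: sets_pair_measure_cong)
  show "space \<kappa> = UNIV"
    using sets_eq_imp_space_eq[OF sets] by (simp add: space_pair_measure)
  show "distr \<kappa> borel fst = P"
    using assms distr_cong[OF refl assms(2), of \<kappa> fst fst] by (simp add: couplings_def)
  show "distr \<kappa> borel snd = Q"
    using assms distr_cong[OF refl assms(3), of \<kappa> snd snd] by (simp add: couplings_def)
qed

section \<open>Measurability and Fubini for orthant events\<close>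

lemma measurable_measure_le_not_le:
  fixes a b :: "'p \<Rightarrow> 'a::ordered_euclidean_space"
  assumes "prob_space M" and [measurable]: "a \<in> borel_measurable M" "b \<in> borel_measurable M"
  shows "(\<lambda>z. measure M {p\<in>space M. b p \<le> z \<and> \<not> a p \<le> z}) \<in> borel_measurable borel"
proof -
  interpret prob_space M by fact
  \<comment> \<open>Written as an integral of an indicator that is jointly measurable in
    \<open>z\<close> and \<open>p\<close> once the order is unfolded into coordinates.\<close>
  have "(\<lambda>z. \<integral>p. indicator {p\<in>space M. b p \<le> z \<and> \<not> a p \<le> z} p \<partial>M :: real) \<in> borel_measurable borel"
    unfolding eucl_le[where 'a='a] by measurable
  then show ?thesis by (simp add: Int_absorb2 Collect_restrict)
qed

lemma measurable_dist_fun[measurable]: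
  assumes "prob_space P" "sets P = sets borel"
  shows "dist_fun P \<in> borel_measurable borel"
proof -
  interpret prob_space P by fact
  note [measurable_cong] = assms(2)
  have sp: "space P = UNIV" using sets_eq_imp_space_eq[OF assms(2)] by simp
  have "(\<lambda>z. \<integral>p. indicator {p. p \<le> z} p \<partial>P :: real) \<in> borel_measurable borel"
    unfolding eucl_le[where 'a='a] by measurable
  then show ?thesis by (simp add: dist_fun_def[abs_def] sp atMost_def)
qed

lemma set_integrable_box:
  fixes f :: "'a::ordered_euclidean_space \<Rightarrow> real"
  assumes [measurable]: "f \<in> borel_measurable borel" and "\<And>z. \<bar>f z\<bar> \<le> 1"
  shows "set_integrable lborel {a..b} f"
  unfolding set_integrable_def
proof (rule Bochner_Integration.integrable_bound)
  have "emeasure lborel {a..b} < \<infinity>"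
    using emeasure_lborel_cbox_finite by (simp only: interval_cbox)
  then show "integrable lborel (indicator {a..b} :: 'a \<Rightarrow> real)"
    by (intro integrable_real_indicator) auto
qed (use assms in \<open>auto split: split_indicator\<close>)

text \<open>For two points of the box the positive part of the score difference is the indicator of
  \<open>b p \<le> z \<and> \<not> a p \<le> z\<close>. Integrating over \<open>p\<close> first
  gives the probability form; integrating over \<open>z\<close> first gives a volume for each pair,
  which the case \<gamma> = 0 uses.\<close>

lemma set_integral_score_gap:
  fixes a b :: "'p \<Rightarrow> 'a::ordered_euclidean_space"
  assumes "prob_space M" and [measurable]: "a \<in> borel_measurable M" "b \<in> borel_measurable M"
    and AE: "AE p in M. p \<in> S" and [measurable]: "S \<in> sets M" and S: "\<And>p. p \<in> S \<Longrightarrow> a p \<in> {xl..xu} \<and> b p \<in> {xl..xu}"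
  shows "(LINT p:S|M. (LINT z|restrict_space lborel {xl..t}.
            max (lower_orthant_score xl xu z (a p) - lower_orthant_score xl xu z (b p)) 0))
       = (LINT z:{xl..t}|lborel. measure M {p\<in>space M. b p \<le> z \<and> \<not> a p \<le> z})" (is "?L = ?R")
    and "(LINT p:S|M. (LINT z|restrict_space lborel {xl..t}.
            max (lower_orthant_score xl xu z (a p) - lower_orthant_score xl xu z (b p)) 0))
       = (\<integral>p. measure lborel {z\<in>{xl..t}. b p \<le> z \<and> \<not> a p \<le> z} \<partial>M)" (is "_ = ?R'")
    and "integrable M (\<lambda>p. measure lborel {z\<in>{xl..t}. b p \<le> z \<and> \<not> a p \<le> z})" (is ?I)
proof -
  interpret M: prob_space M by fact
  interpret pair_sigma_finite M "lborel :: 'a measure" ..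
  let ?A = "\<lambda>z p. indicator {xl..t} z * indicator {p\<in>space M. b p \<le> z \<and> \<not> a p \<le> z} p :: real"
  have fin: "emeasure lborel {xl..t} < \<infinity>"
    using emeasure_lborel_cbox_finite by (simp only: interval_cbox)
  have mA: "(\<lambda>(p, z). ?A z p) \<in> borel_measurable (M \<Otimes>\<^sub>M lborel)"
    unfolding eucl_le[where 'a='a] by measurable
  have int: "integrable (M \<Otimes>\<^sub>M lborel) (\<lambda>(p, z). ?A z p)"
  proof (rule Bochner_Integration.integrable_bound[OF _ mA])
    have "emeasure (M \<Otimes>\<^sub>M lborel) (space M \<times> {xl..t}) = emeasure lborel {xl..t}"
      by (subst lborel.emeasure_pair_measure_Times) (auto simp: M.emeasure_space_1)
    then show "integrable (M \<Otimes>\<^sub>M lborel) (indicator (space M \<times> {xl..t}) :: _ \<Rightarrow> real)"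
      using fin by (intro integrable_real_indicator) auto
  qed (auto intro!: AE_I2 simp: indicator_def)
  have inner: "(\<integral>z. ?A z p \<partial>lborel) = measure lborel {z\<in>{xl..t}. b p \<le> z \<and> \<not> a p \<le> z}"
    if "p \<in> space M" for p
  proof -
    have "(\<lambda>z. ?A z p) = indicator {z\<in>{xl..t}. b p \<le> z \<and> \<not> a p \<le> z}"
      using that by (auto simp: fun_eq_iff split: split_indicator)
    then show ?thesis by simp
  qed
  have m_inner: "(\<lambda>p. \<integral>z. ?A z p \<partial>lborel) \<in> borel_measurable M"
    using mA by (intro lborel.borel_measurable_lebesgue_integral) simp
  have eq: "indicator S p *\<^sub>R (LINT z|restrict_space lborel {xl..t}.
      max (lower_orthant_score xl xu z (a p) - lower_orthant_score xl xu z (b p)) 0)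
      = indicator S p *\<^sub>R (\<integral>z. ?A z p \<partial>lborel)"
    if p: "p \<in> space M" for p
  proof (cases "p \<in> S")
    case True
    then show ?thesis
      using S[OF True] p
      by (subst integral_restrict_space)
         (auto simp: lower_orthant_score_def intro!: Bochner_Integration.integral_cong split: split_indicator)
  qed simp
  have "?L = (\<integral>p. indicator S p *\<^sub>R (\<integral>z. ?A z p \<partial>lborel) \<partial>M)"
    unfolding set_lebesgue_integral_def using eq by (intro Bochner_Integration.integral_cong) auto
  also have "\<dots> = (\<integral>p. (\<integral>z. ?A z p \<partial>lborel) \<partial>M)"
    using AE m_inner by (intro integral_cong_AE) auto
  finally have L: "?L = (\<integral>p. (\<integral>z. ?A z p \<partial>lborel) \<partial>M)" .
  then show "?L = ?R'"
    using inner by (simp cong: Bochner_Integration.integral_cong)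
  show ?I
    using integrable_fst'[OF int] inner by (simp cong: Bochner_Integration.integrable_cong)
  note L
  also have "(\<integral>p. (\<integral>z. ?A z p \<partial>lborel) \<partial>M) = (\<integral>z. (\<integral>p. ?A z p \<partial>M) \<partial>lborel)"
    using Fubini_integral[OF int] by simp
  also have "\<dots> = ?R"
    unfolding set_lebesgue_integral_def
    by (intro Bochner_Integration.integral_cong) (auto simp: Int_absorb2 Collect_restrict)
  finally show "?L = ?R" .
qed

section \<open>Gap and gain of a coupling\<close>

definition orthant_gap :: "('a::ordered_euclidean_space \<times> 'a) measure \<Rightarrow> 'a \<Rightarrow> real" where
  "orthant_gap \<kappa> z = measure \<kappa> {p. snd p \<le> z \<and> \<not> fst p \<le> z}"

definition orthant_gain :: "('a::ordered_euclidean_space \<times> 'a) measure \<Rightarrow> 'a \<Rightarrow> real" where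
  "orthant_gain \<kappa> z = measure \<kappa> {p. fst p \<le> z \<and> \<not> snd p \<le> z}"

locale box_coupling =
  fixes xl xu :: "'a::ordered_euclidean_space" and P Q :: "'a measure" and \<kappa> :: "('a \<times> 'a) measure"
  assumes P: "borel_law_on {xl..xu} P" and Q: "borel_law_on {xl..xu} Q" and \<kappa>: "\<kappa> \<in> couplings P Q"
begin

lemma sets_PQ: "sets P = sets borel" "sets Q = sets borel"
  using P Q by (auto simp: borel_law_on_def)

lemma prob_PQ: "prob_space P" "prob_space Q"
  using P Q by (auto simp: borel_law_on_def)

lemmas coupling = couplingsD[OF \<kappa> sets_PQ]

sublocale prob_space \<kappa> by (rule coupling)

lemma proj_measurable: "fst \<in> borel_measurable \<kappa>" "snd \<in> borel_measurable \<kappa>"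
  by (simp_all add: measurable_cong_sets[OF coupling(2) refl])

lemma AE_box: "AE p in \<kappa>. p \<in> {xl..xu} \<times> {xl..xu}"
proof -
  have "AE x in distr \<kappa> borel fst. x \<in> {xl..xu}" "AE x in distr \<kappa> borel snd. x \<in> {xl..xu}"
    using borel_law_on_AE[OF P] borel_law_on_AE[OF Q] by (simp_all only: coupling(4,5))
  from AE_distrD[OF proj_measurable(1) this(1)] AE_distrD[OF proj_measurable(2) this(2)]
  show ?thesis by eventually_elim auto
qed

lemma box_sets: "{xl..xu} \<times> {xl..xu} \<in> sets \<kappa>"
  by (simp add: coupling)

lemma gap_integral:
  "(LINT p:({xl..xu} \<times> {xl..xu})|\<kappa>. (LINT z|restrict_space lborel {xl..t}.
      max (lower_orthant_score xl xu z (fst p) - lower_orthant_score xl xu z (snd p)) 0))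
   = (LINT z:{xl..t}|lborel. orthant_gap \<kappa> z)"
  "(LINT p:({xl..xu} \<times> {xl..xu})|\<kappa>. (LINT z|restrict_space lborel {xl..t}.
      max (lower_orthant_score xl xu z (fst p) - lower_orthant_score xl xu z (snd p)) 0))
   = (\<integral>p. measure lborel {z\<in>{xl..t}. snd p \<le> z \<and> \<not> fst p \<le> z} \<partial>\<kappa>)"
  "integrable \<kappa> (\<lambda>p. measure lborel {z\<in>{xl..t}. snd p \<le> z \<and> \<not> fst p \<le> z})"
  using set_integral_score_gap[OF prob_space_axioms proj_measurable AE_box box_sets, of xl xu t]
  by (auto simp: orthant_gap_def coupling(3))

lemma gain_integral:
  "(LINT p:({xl..xu} \<times> {xl..xu})|\<kappa>. (LINT z|restrict_space lborel {xl..t}.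
      max (lower_orthant_score xl xu z (snd p) - lower_orthant_score xl xu z (fst p)) 0))
   = (LINT z:{xl..t}|lborel. orthant_gain \<kappa> z)"
  using set_integral_score_gap(1)[OF prob_space_axioms proj_measurable(2,1) AE_box box_sets, of xl xu t]
  by (auto simp: orthant_gain_def coupling(3))

lemma gap_gain_measurable: "orthant_gap \<kappa> \<in> borel_measurable borel" "orthant_gain \<kappa> \<in> borel_measurable borel"
  using measurable_measure_le_not_le[OF prob_space_axioms proj_measurable]
    measurable_measure_le_not_le[OF prob_space_axioms proj_measurable(2,1)]
  by (simp_all add: orthant_gap_def[abs_def] orthant_gain_def[abs_def] coupling(3))

lemma gap_gain_integrable:
  "set_integrable lborel {a..b} (orthant_gap \<kappa>)" "set_integrable lborel {a..b} (orthant_gain \<kappa>)"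
  by (intro set_integrable_box gap_gain_measurable; simp add: orthant_gap_def orthant_gain_def)+

text \<open>The event that both coordinates lie below \<open>z\<close> cancels, leaving only the
  marginals.\<close>

lemma gap_minus_gain: "orthant_gap \<kappa> z - orthant_gain \<kappa> z = dist_fun Q z - dist_fun P z"
proof -
  have [measurable]: "{p. fst p \<le> z} \<in> sets \<kappa>" "{p. snd p \<le> z} \<in> sets \<kappa>"
    using measurable_sets[OF proj_measurable(1), of "{..z}"] measurable_sets[OF proj_measurable(2), of "{..z}"]
    by (simp_all add: vimage_def coupling(3))
  have P: "dist_fun P z = measure \<kappa> {p. fst p \<le> z}"
    unfolding dist_fun_def coupling(4)[symmetric]
    by (subst measure_distr[OF proj_measurable(1)]) (simp_all add: vimage_def coupling(3))
  have Q: "dist_fun Q z = measure \<kappa> {p. snd p \<le> z}"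
    unfolding dist_fun_def coupling(5)[symmetric]
    by (subst measure_distr[OF proj_measurable(2)]) (simp_all add: vimage_def coupling(3))
  have "orthant_gap \<kappa> z = measure \<kappa> ({p. snd p \<le> z} - {p. fst p \<le> z})"
    by (simp add: orthant_gap_def set_diff_eq)
  moreover have "orthant_gain \<kappa> z = measure \<kappa> ({p. fst p \<le> z} - {p. snd p \<le> z})"
    by (simp add: orthant_gain_def set_diff_eq)
  ultimately show ?thesis
    unfolding P Q by (simp add: finite_measure_Diff' Int_commute)
qed

lemma dist_fun_integrable:
  "set_integrable lborel {a..b} (dist_fun P)" "set_integrable lborel {a..b} (dist_fun Q)"
  using measurable_dist_fun[OF prob_PQ(1) sets_PQ(1)] measurable_dist_fun[OF prob_PQ(2) sets_PQ(2)]
  by (intro set_integrable_box; simp add: dist_fun_def prob_space.prob_le_1 prob_PQ)+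

lemma integral_gap_minus_gain:
  "(LINT z:{a..b}|lborel. orthant_gap \<kappa> z) - (LINT z:{a..b}|lborel. orthant_gain \<kappa> z)
   = (LINT z:{a..b}|lborel. dist_fun Q z) - (LINT z:{a..b}|lborel. dist_fun P z)"
  unfolding set_integral_diff(2)[OF gap_gain_integrable, symmetric]
    set_integral_diff(2)[OF dist_fun_integrable(2,1), symmetric] gap_minus_gain ..

end

lemma csd_lower_orthant_iff:
  fixes xl xu :: "'a::ordered_euclidean_space"
  assumes "borel_law_on {xl..xu} P" "borel_law_on {xl..xu} Q"
  shows "csd {xl..xu} (lower_orthant_score xl xu) (restrict_space lborel {xl..t}) \<gamma> P Q \<longleftrightarrow>
    (\<exists>\<kappa>\<in>couplings P Q. (LINT z:{xl..t}|lborel. orthant_gap \<kappa> z) \<le> \<gamma> * (LINT z:{xl..t}|lborel. orthant_gain \<kappa> z))"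
  unfolding csd_def
proof (rule bex_cong[OF refl])
  fix \<kappa> assume "\<kappa> \<in> couplings P Q"
  then interpret box_coupling xl xu P Q \<kappa>
    using assms by unfold_locales
  show "((LINT p:({xl..xu} \<times> {xl..xu})|\<kappa>. (LINT z|restrict_space lborel {xl..t}.
      max (lower_orthant_score xl xu z (fst p) - lower_orthant_score xl xu z (snd p)) 0))
    \<le> \<gamma> * (LINT p:({xl..xu} \<times> {xl..xu})|\<kappa>. (LINT z|restrict_space lborel {xl..t}.
      max (lower_orthant_score xl xu z (snd p) - lower_orthant_score xl xu z (fst p)) 0)))
    \<longleftrightarrow> (LINT z:{xl..t}|lborel. orthant_gap \<kappa> z) \<le> \<gamma> * (LINT z:{xl..t}|lborel. orthant_gain \<kappa> z)"
    by (simp only: gap_integral(1) gain_integral)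
qed

text \<open>Supplies one coupling for the case \<gamma> = 1, where any coupling decides the
  inequality.\<close>

lemma product_coupling:
  assumes "prob_space P" "prob_space Q"
  shows "P \<Otimes>\<^sub>M Q \<in> couplings P Q"
proof -
  interpret p1: prob_space P by fact
  interpret p2: prob_space Q by fact
  interpret pq: pair_prob_space P Q ..
  have "distr (P \<Otimes>\<^sub>M Q) Q snd = Q"
  proof (rule measure_eqI)
    fix A assume "A \<in> sets (distr (P \<Otimes>\<^sub>M Q) Q snd)"
    then have A: "A \<in> sets Q" by simp
    have "snd -` A \<inter> space (P \<Otimes>\<^sub>M Q) = space P \<times> A"
      using sets.sets_into_space[OF A] by (auto simp: space_pair_measure)
    then show "emeasure (distr (P \<Otimes>\<^sub>M Q) Q snd) A = emeasure Q A"
      using A by (simp add: emeasure_distr p2.emeasure_pair_measure_Times p1.emeasure_space_1)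
  qed simp
  then show ?thesis
    using pq.prob_space_axioms p2.distr_pair_fst by (simp add: couplings_def)
qed

section \<open>The case \<gamma> = 1\<close>

lemma set_integral_dist_fun_atMost:
  fixes xl xu t :: "'a::ordered_euclidean_space"
  assumes "borel_law_on {xl..xu} P"
  shows "(LINT z:{..t}|lborel. dist_fun P z) = (LINT z:{xl..t}|lborel. dist_fun P z)"
proof -
  interpret prob_space P using assms by (simp add: borel_law_on_def)
  \<comment> \<open>Almost every \<open>x\<close> satisfies \<open>xl \<le> x\<close>, so
    \<open>x \<le> z\<close> would force \<open>xl \<le> z\<close>.\<close>
  have "dist_fun P z = 0" if "\<not> xl \<le> z" for z
  proof -
    have "AE x in P. x \<notin> {..z}"
      using borel_law_on_AE[OF assms] by eventually_elim (use that in \<open>auto dest: order.trans\<close>)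
    then show ?thesis
      unfolding dist_fun_def using assms
      by (subst prob_eq_0) (auto simp: borel_law_on_def)
  qed
  then show ?thesis
    unfolding set_lebesgue_integral_def
    by (intro Bochner_Integration.integral_cong) (auto split: split_indicator)
qed

text \<open>At \<gamma> = 1 the inequality says that the integral of gap minus gain is at most zero,
  and that integral depends only on \<open>P\<close> and \<open>Q\<close>.\<close>

theorem lower_orthant_csd_one_iff:
  fixes xl xu :: "'a::ordered_euclidean_space"
  assumes P: "borel_law_on {xl..xu} P" and Q: "borel_law_on {xl..xu} Q"
  shows "lower_orthant_csd xl xu 1 P Q \<longleftrightarrow> lower_orthant_sd2 P Q"
proof -
  have one: "csd {xl..xu} (lower_orthant_score xl xu) (restrict_space lborel {xl..t}) 1 P Q \<longleftrightarrow>
      (LINT z:{..t}|lborel. dist_fun Q z) \<le> (LINT z:{..t}|lborel. dist_fun P z)" for t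
  proof -
    have "(LINT z:{xl..t}|lborel. orthant_gap \<kappa> z) \<le> (LINT z:{xl..t}|lborel. orthant_gain \<kappa> z) \<longleftrightarrow>
        (LINT z:{..t}|lborel. dist_fun Q z) \<le> (LINT z:{..t}|lborel. dist_fun P z)"
      if "\<kappa> \<in> couplings P Q" for \<kappa>
    proof -
      interpret box_coupling xl xu P Q \<kappa> using P Q that by unfold_locales
      show ?thesis
        using integral_gap_minus_gain[of xl t]
        by (simp add: set_integral_dist_fun_atMost[OF P] set_integral_dist_fun_atMost[OF Q]) linarith
    qed
    moreover have "P \<Otimes>\<^sub>M Q \<in> couplings P Q"
      using P Q by (intro product_coupling) (auto simp: borel_law_on_def)
    ultimately show ?thesis
      unfolding csd_lower_orthant_iff[OF P Q] by auto
  qed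
  \<comment> \<open>Second-degree dominance also quantifies over \<open>t\<close> not above
    \<open>xl\<close>; there both integrals vanish.\<close>
  have "(LINT z:{..t}|lborel. dist_fun Q z) = (LINT z:{..t}|lborel. dist_fun P z)" if "\<not> xl \<le> t" for t
  proof -
    have "{xl..t} = {}" using that by simp
    then show ?thesis
      by (simp only: set_integral_dist_fun_atMost[OF P] set_integral_dist_fun_atMost[OF Q])
         (simp add: set_lebesgue_integral_def)
  qed
  then show ?thesis
    unfolding lower_orthant_csd_def lower_orthant_sd2_def one by (metis order_refl)
qed

section \<open>The case \<gamma> = 0\<close>

lemma measure_lborel_score_gap_pos:
  fixes x y t :: "'a::ordered_euclidean_space"
  assumes "xl \<le> y" "\<not> x \<le> y" and t: "\<And>i. i \<in> Basis \<Longrightarrow> x \<bullet> i < t \<bullet> i \<and> y \<bullet> i < t \<bullet> i"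
  shows "measure lborel {z\<in>{xl..t}. y \<le> z \<and> \<not> x \<le> z} > 0"
proof -
  obtain i where i: "i \<in> Basis" "y \<bullet> i < x \<bullet> i"
    using assms(2) by (auto simp: eucl_le[where 'a='a] not_le)
  \<comment> \<open>In coordinate \<open>i\<close> the order \<open>x \<le> y\<close> fails. Cutting
    \<open>t\<close> there down to the level of \<open>x\<close> makes \<open>box y w\<close> a set
    of positive volume whose points lie above \<open>y\<close> and below \<open>t\<close>, but not
    above \<open>x\<close>.\<close>
  define w where "w = t - (t \<bullet> i - x \<bullet> i) *\<^sub>R i"
  have w: "w \<bullet> j = (if j = i then x \<bullet> i else t \<bullet> j)" if "j \<in> Basis" for j
    using that i by (auto simp: w_def inner_diff_left inner_Basis)
  have yw: "y \<bullet> j < w \<bullet> j" "w \<bullet> j \<le> t \<bullet> j" if "j \<in> Basis" for j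
    using w[OF that] i t[OF that] by (auto intro: less_imp_le)
  have [measurable]: "{z\<in>{xl..t}. y \<le> z \<and> \<not> x \<le> z} \<in> sets lborel"
    unfolding eucl_le[where 'a='a] by measurable
  have "0 < (\<Prod>j\<in>Basis. (w - y) \<bullet> j)"
    using yw by (intro prod_pos) (auto simp: inner_diff_left)
  also have "\<dots> = measure lborel (box y w)"
    using yw by (subst measure_lborel_box_eq) (auto intro: less_imp_le)
  also have "\<dots> \<le> measure lborel {z\<in>{xl..t}. y \<le> z \<and> \<not> x \<le> z}"
  proof (rule measure_mono_fmeasurable)
    show "box y w \<subseteq> {z\<in>{xl..t}. y \<le> z \<and> \<not> x \<le> z}"
    proof
      fix z assume z: "z \<in> box y w"
      then have "y \<le> z" "z \<le> t"
        using yw by (auto simp: mem_box eucl_le[where 'a='a] intro: less_imp_le)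
          (meson less_imp_le order.trans)
      moreover have "\<not> x \<le> z"
        using z i w[OF i(1)] by (force simp: mem_box eucl_le[where 'a='a] not_le)
      ultimately show "z \<in> {z\<in>{xl..t}. y \<le> z \<and> \<not> x \<le> z}"
        using assms(1) by (auto intro: order.trans)
    qed
    have "{z\<in>{xl..t}. y \<le> z \<and> \<not> x \<le> z} \<subseteq> cbox xl t" by (auto simp: interval_cbox)
    then show "{z\<in>{xl..t}. y \<le> z \<and> \<not> x \<le> z} \<in> fmeasurable lborel"
      by (rule fmeasurableI2[rotated]) auto
  qed simp
  finally show ?thesis .
qed

text \<open>A single \<open>t\<close> beyond the box already forces a coupling with
  \<open>fst p \<le> snd p\<close> almost surely. Conversely, a Strassen coupling has zero gap at
  every \<open>z\<close>, so it serves all \<open>t\<close> together.\<close>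

theorem lower_orthant_csd_zero_iff:
  fixes xl xu :: "'a::ordered_euclidean_space"
  assumes le: "xl \<le> xu" and P: "borel_law_on {xl..xu} P" and Q: "borel_law_on {xl..xu} Q"
  shows "lower_orthant_csd xl xu 0 P Q \<longleftrightarrow> fosd P Q"
proof
  assume csd: "lower_orthant_csd xl xu 0 P Q"
  \<comment> \<open>Strictly above \<open>xu\<close> in every coordinate, so pairs touching the
    upper boundary also leave room for a box of positive volume.\<close>
  define t where "t = xu + One"
  have ti: "x \<bullet> i < t \<bullet> i" if "i \<in> Basis" "x \<le> xu" for x i
    using that by (auto simp: t_def inner_add_left eucl_le[where 'a='a] intro: le_less_trans)
  have "xl \<le> t"
    using le by (auto simp: t_def eucl_le[where 'a='a] inner_add_left intro: add_increasing2)
  with csd obtain \<kappa> where \<kappa>: "\<kappa> \<in> couplings P Q"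
    and gap: "(LINT z:{xl..t}|lborel. orthant_gap \<kappa> z) \<le> 0"
    unfolding lower_orthant_csd_def csd_lower_orthant_iff[OF P Q] by fastforce
  interpret box_coupling xl xu P Q \<kappa> using P Q \<kappa> by unfold_locales
  let ?m = "\<lambda>p. measure lborel {z\<in>{xl..t}. snd p \<le> z \<and> \<not> fst p \<le> z}"
  have "(\<integral>p. ?m p \<partial>\<kappa>) \<le> 0" using gap gap_integral(1,2)[of t] by simp
  \<comment> \<open>The integrand is a volume, hence nonnegative; a zero integral makes it vanish
    almost everywhere.\<close>
  then have "(\<integral>p. ?m p \<partial>\<kappa>) = 0"
    by (intro antisym Bochner_Integration.integral_nonneg) auto
  then have "AE p in \<kappa>. ?m p = 0"
    using integral_nonneg_eq_0_iff_AE[OF gap_integral(3)[of t]] by simp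
  then have AE_le: "AE p in \<kappa>. fst p \<le> snd p"
    using AE_box
  proof eventually_elim
    case (elim p)
    show ?case
    proof (rule ccontr)
      assume "\<not> fst p \<le> snd p"
      then have "?m p > 0"
        using elim(2) by (intro measure_lborel_score_gap_pos) (auto intro!: ti)
      with elim(1) show False by simp
    qed
  qed
  show "fosd P Q"
    unfolding fosd_def
  proof (intro allI impI)
    fix A :: "'a set" assume A: "closed A \<and> (\<forall>x\<in>A. \<forall>y\<le>x. y \<in> A)"
    then have [measurable]: "A \<in> sets borel" by (simp add: borel_closed)
    have mA: "fst -` A \<in> sets \<kappa>"
      using measurable_sets[OF proj_measurable(1), of A] by (simp add: coupling(3))
    have "measure Q A = measure \<kappa> (snd -` A)"
      unfolding coupling(5)[symmetric] by (subst measure_distr[OF proj_measurable(2)]) (simp_all add: coupling(3))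
    also have "\<dots> \<le> measure \<kappa> (fst -` A)"
      using AE_le A mA by (intro finite_measure_mono_AE) (auto elim!: eventually_mono)
    also have "\<dots> = measure P A"
      unfolding coupling(4)[symmetric] by (subst measure_distr[OF proj_measurable(1)]) (simp_all add: coupling(3))
    finally show "measure P A \<ge> measure Q A" .
  qed
next
  assume fosd: "fosd P Q"
  obtain \<kappa> where \<kappa>: "\<kappa> \<in> couplings P Q" and AE_le: "AE p in \<kappa>. fst p \<le> snd p"
    using strassen_box[OF _ _ borel_law_on_AE[OF P] _ _ borel_law_on_AE[OF Q] fosd] P Q
    by (auto simp: borel_law_on_def)
  interpret box_coupling xl xu P Q \<kappa> using P Q \<kappa> by unfold_locales
  have "orthant_gap \<kappa> z = 0" for z
  proof -
    have "AE p in \<kappa>. \<not> (snd p \<le> z \<and> \<not> fst p \<le> z)"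
      using AE_le by eventually_elim (auto dest: order.trans)
    from emeasure_eq_0_AE[OF this] show ?thesis
      by (simp add: orthant_gap_def measure_def coupling(3))
  qed
  then have "(LINT z:A|lborel. orthant_gap \<kappa> z) = 0" for A
    by (simp add: set_lebesgue_integral_def)
  then show "lower_orthant_csd xl xu 0 P Q"
    unfolding lower_orthant_csd_def csd_lower_orthant_iff[OF P Q] using \<kappa> by (auto intro!: bexI[of _ \<kappa>])
qed

section \<open>The one-dimensional case\<close>

text \<open>Both quantile functions \<open>A.I\<close> and \<open>B.I\<close> are driven by one
  uniform variable. The Galois connection with the distribution functions turns the gap event into
  an interval of levels.\<close>

lemma comonotone_coupling:
  fixes P Q :: "real measure"
  assumes "real_distribution P" "real_distribution Q"
  obtains \<kappa> where "\<kappa> \<in> couplings P Q" "\<And>z. orthant_gap \<kappa> z = max (dist_fun Q z - dist_fun P z) 0"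
proof -
  interpret A: cdf_distribution P using assms(1) by (simp add: cdf_distribution_def)
  interpret B: cdf_distribution Q using assms(2) by (simp add: cdf_distribution_def)
  let ?\<Omega> = "restrict_space lborel {0<..<1::real}"
  interpret \<Omega>: prob_space ?\<Omega>
    by (auto simp add: emeasure_restrict_space space_restrict_space intro!: prob_spaceI)
  have sets\<Omega>: "sets ?\<Omega> = sets (restrict_space borel {0<..<1})"
    by (rule sets_restrict_space_cong) simp
  have [measurable]: "A.I \<in> borel_measurable ?\<Omega>" "B.I \<in> borel_measurable ?\<Omega>"
    using A.measurable_CI B.measurable_CI by (simp_all add: measurable_cong_sets[OF sets\<Omega> refl])
  define \<kappa> where "\<kappa> = distr ?\<Omega> (P \<Otimes>\<^sub>M Q) (\<lambda>\<omega>. (A.I \<omega>, B.I \<omega>))"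
  have m: "(\<lambda>\<omega>. (A.I \<omega>, B.I \<omega>)) \<in> measurable ?\<Omega> (P \<Otimes>\<^sub>M Q)" by measurable
  have "distr \<kappa> P fst = distr ?\<Omega> borel A.I"
    unfolding \<kappa>_def by (subst distr_distr[OF _ m]) (auto simp: comp_def cong: distr_cong)
  then have k1: "distr \<kappa> P fst = P" by (simp add: A.distr_I_eq_M)
  have "distr \<kappa> Q snd = distr ?\<Omega> borel B.I"
    unfolding \<kappa>_def by (subst distr_distr[OF _ m]) (auto simp: comp_def cong: distr_cong)
  then have k2: "distr \<kappa> Q snd = Q" by (simp add: B.distr_I_eq_M)
  have "prob_space \<kappa>" unfolding \<kappa>_def by (rule \<Omega>.prob_space_distr[OF m])
  then have "\<kappa> \<in> couplings P Q" using k1 k2 by (simp add: couplings_def \<kappa>_def)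
  moreover have "orthant_gap \<kappa> z = max (dist_fun Q z - dist_fun P z) 0" for z
  proof -
    have gap_sets: "{p. snd p \<le> z \<and> \<not> fst p \<le> z} \<in> sets (P \<Otimes>\<^sub>M Q)"
    proof -
      have "{p. snd p \<le> z \<and> \<not> fst p \<le> z} = {z<..} \<times> {..z}" by auto
      also have "\<dots> \<in> sets (P \<Otimes>\<^sub>M Q)" by (intro pair_measureI) auto
      finally show ?thesis .
    qed
    have "orthant_gap \<kappa> z = measure ?\<Omega> {\<omega>\<in>{0<..<1}. B.I \<omega> \<le> z \<and> \<not> A.I \<omega> \<le> z}"
      unfolding orthant_gap_def \<kappa>_def
      by (subst measure_distr[OF m gap_sets])
         (auto simp: space_restrict_space intro!: arg_cong2[where f=measure])
    also have "{\<omega>\<in>{0<..<1}. B.I \<omega> \<le> z \<and> \<not> A.I \<omega> \<le> z} = {\<omega>\<in>{0<..<1}. \<omega> \<le> cdf Q z \<and> \<not> \<omega> \<le> cdf P z}"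
      using A.pseudoinverse B.pseudoinverse by auto
    also have "measure ?\<Omega> \<dots> = measure lborel {\<omega>\<in>{0<..<1}. \<omega> \<le> cdf Q z \<and> \<not> \<omega> \<le> cdf P z}"
      by (subst measure_restrict_space) auto
    \<comment> \<open>The two sets can differ only at the endpoint \<open>1\<close>, a null
      set.\<close>
    also have "\<dots> = measure lborel {cdf P z<..cdf Q z}"
      using A.cdf_nonneg[of z] B.cdf_bounded_prob[of z] AE_lborel_singleton[of "1::real"]
      by (auto intro!: arg_cong[where f=enn2real] emeasure_eq_AE simp: measure_def)
    also have "\<dots> = max (cdf Q z - cdf P z) 0"
      by (cases "cdf P z \<le> cdf Q z") auto
    finally show ?thesis by (simp add: dist_fun_def cdf_def)
  qed
  ultimately show ?thesis by (rule that)
qed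

lemma borel_law_on_real_distribution: "borel_law_on D P \<Longrightarrow> real_distribution P"
  by (simp add: borel_law_on_def real_distribution_def real_distribution_axioms_def)

lemma set_integrable_dist_fun_diff:
  fixes P Q :: "'a::ordered_euclidean_space measure"
  assumes "prob_space P" "sets P = sets borel" "prob_space Q" "sets Q = sets borel"
  shows "set_integrable lborel {a..b} (\<lambda>z. max (dist_fun P z - dist_fun Q z) 0)"
proof (rule set_integrable_box)
  have [measurable]: "dist_fun P \<in> borel_measurable borel" "dist_fun Q \<in> borel_measurable borel"
    using assms by (simp_all add: measurable_dist_fun)
  show "(\<lambda>z. max (dist_fun P z - dist_fun Q z) 0) \<in> borel_measurable borel" by measurable
  show "\<bar>max (dist_fun P z - dist_fun Q z) 0\<bar> \<le> 1" for z
    using prob_space.prob_le_1[OF assms(1), of "{..z}"] measure_nonneg[of Q "{..z}"]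
    unfolding dist_fun_def by linarith
qed

text \<open>The comonotone coupling has the least possible gap at every \<open>z\<close>. Since gap
  minus gain is the same for all couplings and \<gamma> \<le> 1, a smaller gap can only help the
  inequality.\<close>

lemma csd_lower_orthant_real_iff:
  fixes xl xu :: real
  assumes P: "borel_law_on {xl..xu} P" and Q: "borel_law_on {xl..xu} Q" and \<gamma>: "0 \<le> \<gamma>" "\<gamma> \<le> 1"
  shows "csd {xl..xu} (lower_orthant_score xl xu) (restrict_space lborel {xl..t}) \<gamma> P Q \<longleftrightarrow>
    (LINT z:{xl..t}|lborel. max (dist_fun Q z - dist_fun P z) 0)
      \<le> \<gamma> * (LINT z:{xl..t}|lborel. max (dist_fun P z - dist_fun Q z) 0)" (is "_ \<longleftrightarrow> ?A \<le> \<gamma> * ?B")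
proof -
  have pq: "prob_space P" "sets P = sets borel" "prob_space Q" "sets Q = sets borel"
    using P Q by (auto simp: borel_law_on_def)
  note int = set_integrable_dist_fun_diff[OF pq] set_integrable_dist_fun_diff[OF pq(3,4,1,2)]
  obtain \<kappa>\<^sub>0 where \<kappa>\<^sub>0: "\<kappa>\<^sub>0 \<in> couplings P Q" and gap\<^sub>0: "\<And>z. orthant_gap \<kappa>\<^sub>0 z = max (dist_fun Q z - dist_fun P z) 0"
    using comonotone_coupling[of P Q] P Q by (auto simp: borel_law_on_real_distribution)
  interpret K: box_coupling xl xu P Q \<kappa>\<^sub>0 using P Q \<kappa>\<^sub>0 by unfold_locales
  have gain\<^sub>0: "orthant_gain \<kappa>\<^sub>0 z = max (dist_fun P z - dist_fun Q z) 0" for z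
    using K.gap_minus_gain[of z] gap\<^sub>0[of z] by (auto simp: max_def split: if_splits)
  show ?thesis
    unfolding csd_lower_orthant_iff[OF P Q]
  proof
    assume "?A \<le> \<gamma> * ?B"
    then show "\<exists>\<kappa>\<in>couplings P Q. (LINT z:{xl..t}|lborel. orthant_gap \<kappa> z) \<le> \<gamma> * (LINT z:{xl..t}|lborel. orthant_gain \<kappa> z)"
      using \<kappa>\<^sub>0 by (intro bexI[of _ \<kappa>\<^sub>0]) (simp_all add: gap\<^sub>0 gain\<^sub>0)
  next
    assume "\<exists>\<kappa>\<in>couplings P Q. (LINT z:{xl..t}|lborel. orthant_gap \<kappa> z) \<le> \<gamma> * (LINT z:{xl..t}|lborel. orthant_gain \<kappa> z)"
    then obtain \<kappa> where \<kappa>: "\<kappa> \<in> couplings P Q"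
      and le: "(LINT z:{xl..t}|lborel. orthant_gap \<kappa> z) \<le> \<gamma> * (LINT z:{xl..t}|lborel. orthant_gain \<kappa> z)"
      by auto
    interpret box_coupling xl xu P Q \<kappa> using P Q \<kappa> by unfold_locales
    \<comment> \<open>Every coupling has nonnegative gap and gain with difference
      \<open>dist_fun Q z - dist_fun P z\<close>.\<close>
    have "max (dist_fun Q z - dist_fun P z) 0 \<le> orthant_gap \<kappa> z" for z
    proof -
      have "0 \<le> orthant_gap \<kappa> z" "0 \<le> orthant_gain \<kappa> z"
        by (auto simp: orthant_gap_def orthant_gain_def)
      then show ?thesis using gap_minus_gain[of z] by linarith
    qed
    then have A: "?A \<le> (LINT z:{xl..t}|lborel. orthant_gap \<kappa> z)"
      using int gap_gain_integrable by (intro set_integral_mono) auto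
    have AB: "?A - ?B = (LINT z:{xl..t}|lborel. orthant_gap \<kappa> z) - (LINT z:{xl..t}|lborel. orthant_gain \<kappa> z)"
      using K.integral_gap_minus_gain[of xl t] integral_gap_minus_gain[of xl t] by (simp add: gap\<^sub>0 gain\<^sub>0)
    \<comment> \<open>\<open>A - \<gamma> B = (1 - \<gamma>) A + \<gamma> (A - B)\<close>, where \<open>A - B\<close> does not depend on the coupling.\<close>
    have "?A - \<gamma> * ?B = (1 - \<gamma>) * ?A + \<gamma> * (?A - ?B)"
      by (simp add: algebra_simps)
    also have "\<dots> \<le> (1 - \<gamma>) * (LINT z:{xl..t}|lborel. orthant_gap \<kappa> z) + \<gamma> * (?A - ?B)"
      using A \<gamma> by (intro add_right_mono mult_left_mono) auto
    also have "\<dots> = (LINT z:{xl..t}|lborel. orthant_gap \<kappa> z) - \<gamma> * (LINT z:{xl..t}|lborel. orthant_gain \<kappa> z)"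
      unfolding AB by (simp add: algebra_simps)
    also have "\<dots> \<le> 0" using le by simp
    finally show "?A \<le> \<gamma> * ?B" by simp
  qed
qed

section \<open>Utility differences as integrals against the derivative\<close>

lemma borel_measurable_real_derivative:
  fixes u u' :: "real \<Rightarrow> real"
  assumes d: "\<And>x. (u has_real_derivative u' x) (at x)"
  shows "u' \<in> borel_measurable borel"
proof (rule borel_measurable_LIMSEQ_real)
  have "continuous_on UNIV u"
    using d by (intro continuous_at_imp_continuous_on) (auto intro: DERIV_isCont)
  then have [measurable]: "u \<in> borel_measurable borel" by (rule borel_measurable_continuous_onI)
  \<comment> \<open>The derivative may be discontinuous; it is a pointwise limit of continuous
    difference quotients.\<close>
  show "(\<lambda>x. (u (x + inverse (real (Suc n))) - u x) / inverse (real (Suc n))) \<in> borel_measurable borel" for n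
    by measurable
  show "(\<lambda>n. (u (x + inverse (real (Suc n))) - u x) / inverse (real (Suc n))) \<longlonglongrightarrow> u' x" for x
  proof -
    have "((\<lambda>h. (u (x + h) - u x) / h) \<longlongrightarrow> u' x) (at 0)"
      using d[of x] by (simp add: DERIV_def)
    moreover have "filterlim (\<lambda>n. inverse (real (Suc n))) (at 0) sequentially"
      using LIMSEQ_inverse_real_of_nat by (intro filterlim_atI) auto
    ultimately show ?thesis by (rule filterlim_compose)
  qed
qed

text \<open>Write \<open>u x\<close> as \<open>u xl\<close> plus the integral of \<open>u'\<close>
  up to \<open>x\<close> and exchange the order of integration; the inner integral becomes the
  survival probability \<open>1 - dist_fun P z\<close>.\<close>

lemma expectation_eq_integral_survival:
  fixes u u' :: "real \<Rightarrow> real"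
  assumes P: "borel_law_on {xl..xu} P" and le: "xl \<le> xu"
    and d: "\<And>x. (u has_real_derivative u' x) (at x)" and nonneg: "\<And>x. 0 \<le> u' x"
  shows "(LINT x|P. u x) = u xl + (LINT z:{xl..xu}|lborel. u' z * (1 - dist_fun P z))"
proof -
  interpret real_distribution P using P by (rule borel_law_on_real_distribution)
  interpret pair_sigma_finite P "lborel :: real measure" ..
  have [measurable]: "u' \<in> borel_measurable borel" using d by (rule borel_measurable_real_derivative)
  let ?f = "\<lambda>x z. u' z * indicator {xl..xu} z * indicator {..<x} z"
  \<comment> \<open>Nonnegativity makes the derivative integrable on the interval, without
    continuity.\<close>
  have iu: "integrable lborel (\<lambda>z. u' z * indicator {xl..xu} z)"
    using d nonneg le by (intro integrable_FTC_Icc_nonneg) auto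
  have mf: "(\<lambda>(x, z). ?f x z) \<in> borel_measurable (P \<Otimes>\<^sub>M lborel)"
    unfolding lessThan_def by measurable
  have iz: "integrable lborel (\<lambda>z. ?f x z)" for x
    by (rule Bochner_Integration.integrable_bound[OF iu]) (auto split: split_indicator simp: nonneg)
  have int: "integrable (P \<Otimes>\<^sub>M lborel) (\<lambda>(x, z). ?f x z)"
  proof (rule Bochner_Integration.integrable_bound[OF _ mf])
    show "integrable (P \<Otimes>\<^sub>M lborel) (\<lambda>(x, z). u' z * indicator {xl..xu} z)"
      using iu by (intro Fubini_integrable) (auto simp: prob_space)
  qed (auto split: split_indicator simp: nonneg)
  have "u x = u xl + (\<integral>z. ?f x z \<partial>lborel)" if x: "x \<in> {xl..xu}" for x
  proof -
    \<comment> \<open>The strict cut \<open>z < x\<close> in \<open>?f\<close>, chosen to produce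
      the survival probability, differs from \<open>z \<le> x\<close> at one point.\<close>
    have "(\<integral>z. ?f x z \<partial>lborel) = (\<integral>z. u' z * indicator {xl..x} z \<partial>lborel)"
      using AE_lborel_singleton[of x] x
      by (intro integral_cong_AE) (auto split: split_indicator elim!: eventually_mono)
    also have "\<dots> = u x - u xl"
      using d nonneg x by (intro integral_FTC_Icc_nonneg) auto
    finally show ?thesis by simp
  qed
  then have "AE x in P. u x = u xl + (\<integral>z. ?f x z \<partial>lborel)"
    using borel_law_on_AE[OF P] by (rule eventually_mono[rotated])
  moreover have ufst: "integrable P (\<lambda>x. \<integral>z. ?f x z \<partial>lborel)"
    using integrable_fst'[OF int] by simp
  moreover have "u \<in> borel_measurable P"
  proof -
    have "continuous_on UNIV u"
      using d by (intro continuous_at_imp_continuous_on) (auto intro: DERIV_isCont)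
    from borel_measurable_continuous_onI[OF this] show ?thesis by simp
  qed
  ultimately have "(LINT x|P. u x) = (LINT x|P. u xl + (\<integral>z. ?f x z \<partial>lborel))"
    by (intro integral_cong_AE) auto
  also have "\<dots> = u xl + (LINT x|P. (\<integral>z. ?f x z \<partial>lborel))"
    using ufst prob_space by simp
  also have "(LINT x|P. (\<integral>z. ?f x z \<partial>lborel)) = (\<integral>z. (LINT x|P. ?f x z) \<partial>lborel)"
    using Fubini_integral[OF int] by simp
  also have "\<dots> = (LINT z:{xl..xu}|lborel. u' z * (1 - dist_fun P z))"
    unfolding set_lebesgue_integral_def
  proof (intro Bochner_Integration.integral_cong refl)
    fix z
    have "(\<lambda>x::real. indicator {..<x} z :: real) = indicator {z<..}"
      by (auto split: split_indicator)
    then have "(LINT x|P. indicator {..<x} z :: real) = 1 - dist_fun P z"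
      using prob_compl[of "{..z}"] by (simp add: dist_fun_def Compl_eq_Diff_UNIV[symmetric])
    then show "(LINT x|P. ?f x z) = indicator {xl..xu} z *\<^sub>R (u' z * (1 - dist_fun P z))"
      by (simp add: mult_ac)
  qed
  finally show ?thesis .
qed

lemma expectation_diff_eq_integral:
  fixes u u' :: "real \<Rightarrow> real"
  assumes P: "borel_law_on {xl..xu} P" and Q: "borel_law_on {xl..xu} Q" and le: "xl \<le> xu"
    and d: "\<And>x. (u has_real_derivative u' x) (at x)" and nonneg: "\<And>x. 0 \<le> u' x"
  shows "(LINT x|Q. u x) - (LINT x|P. u x) = (LINT z:{xl..xu}|lborel. u' z * (dist_fun P z - dist_fun Q z))"
    and "set_integrable lborel {xl..xu} (\<lambda>z. u' z * (dist_fun P z - dist_fun Q z))"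
proof -
  interpret p1: real_distribution P using P by (rule borel_law_on_real_distribution)
  interpret p2: real_distribution Q using Q by (rule borel_law_on_real_distribution)
  have [measurable]: "u' \<in> borel_measurable borel" using d by (rule borel_measurable_real_derivative)
  have [measurable]: "dist_fun P \<in> borel_measurable borel" "dist_fun Q \<in> borel_measurable borel"
    using p1.prob_space_axioms p2.prob_space_axioms by (simp_all add: measurable_dist_fun)
  have iu: "integrable lborel (\<lambda>z. u' z * indicator {xl..xu} z)"
    using d nonneg le by (intro integrable_FTC_Icc_nonneg) auto
  have *: "set_integrable lborel {xl..xu} (\<lambda>z. u' z * v z)"
    if [measurable]: "v \<in> borel_measurable borel" and v: "\<And>z. \<bar>v z\<bar> \<le> 1" for v
    unfolding set_integrable_def
    by (rule Bochner_Integration.integrable_bound[OF iu])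
       (use v nonneg in \<open>auto split: split_indicator simp: abs_mult intro!: mult_left_le\<close>)
  have b: "0 \<le> dist_fun P z" "dist_fun P z \<le> 1" "0 \<le> dist_fun Q z" "dist_fun Q z \<le> 1" for z
    by (auto simp: dist_fun_def)
  have "\<bar>1 - dist_fun P z\<bar> \<le> 1" "\<bar>1 - dist_fun Q z\<bar> \<le> 1" "\<bar>dist_fun P z - dist_fun Q z\<bar> \<le> 1" for z
    using b[of z] by auto
  note ints = *[OF _ this(1)] *[OF _ this(2)] *[OF _ this(3)]
  show "set_integrable lborel {xl..xu} (\<lambda>z. u' z * (dist_fun P z - dist_fun Q z))"
    by (rule ints(3)) measurable
  have "(LINT x|Q. u x) - (LINT x|P. u x) = (LINT z:{xl..xu}|lborel. u' z * (1 - dist_fun Q z)) -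
      (LINT z:{xl..xu}|lborel. u' z * (1 - dist_fun P z))"
    using expectation_eq_integral_survival[OF P le d nonneg] expectation_eq_integral_survival[OF Q le d nonneg]
    by simp
  also have "\<dots> = (LINT z:{xl..xu}|lborel. u' z * (1 - dist_fun Q z) - u' z * (1 - dist_fun P z))"
    by (rule set_integral_diff(2)[symmetric]) (rule ints, measurable)+
  also have "\<dots> = (LINT z:{xl..xu}|lborel. u' z * (dist_fun P z - dist_fun Q z))"
    by (simp add: algebra_simps)
  finally show "(LINT x|Q. u x) - (LINT x|P. u x) = (LINT z:{xl..xu}|lborel. u' z * (dist_fun P z - dist_fun Q z))" .
qed

section \<open>From the integral condition to utilities\<close>

lemma integral_antimono_weight_nonneg:
  fixes v h :: "real \<Rightarrow> real"
  assumes h: "h integrable_on {a..b}" and "a \<le> b"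
    and v: "\<And>x y. a \<le> x \<Longrightarrow> x \<le> y \<Longrightarrow> y \<le> b \<Longrightarrow> v y \<le> v x" "0 \<le> v b"
    and H: "\<And>t. t \<in> {a..b} \<Longrightarrow> 0 \<le> integral {a..t} h"
  shows "(\<lambda>x. v x * h x) integrable_on {a..b}" "0 \<le> integral {a..b} (\<lambda>x. v x * h x)"
proof -
  \<comment> \<open>The second mean value theorem expects a nondecreasing weight, hence the sign
    change.\<close>
  obtain c where c: "c \<in> {a..b}"
    and int: "((\<lambda>x. - v x * h x) has_integral (- v a * integral {a..c} h + - v b * integral {c..b} h)) {a..b}"
    using second_mean_value_theorem_full[OF h \<open>a \<le> b\<close>, of "\<lambda>x. - v x"] v by auto
  have "integral {a..c} h + integral {c..b} h = integral {a..b} h"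
    using c h by (intro Henstock_Kurzweil_Integration.integral_combine) auto
  \<comment> \<open>Regrouped by summation by parts, so that only integrals starting at
    \<open>a\<close> occur, with nonnegative coefficients.\<close>
  then have "- (- v a * integral {a..c} h + - v b * integral {c..b} h)
      = (v a - v b) * integral {a..c} h + v b * integral {a..b} h"
    by (auto simp: algebra_simps simp flip: distrib_left)
  with has_integral_neg[OF int]
  have I: "((\<lambda>x. v x * h x) has_integral ((v a - v b) * integral {a..c} h + v b * integral {a..b} h)) {a..b}"
    by simp
  then show "(\<lambda>x. v x * h x) integrable_on {a..b}" by blast
  have "0 \<le> (v a - v b) * integral {a..c} h + v b * integral {a..b} h"
    using H[OF c] H[of b] v(1)[of a b] v(2) \<open>a \<le> b\<close> by (intro add_nonneg_nonneg mult_nonneg_nonneg) auto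
  with I show "0 \<le> integral {a..b} (\<lambda>x. v x * h x)" by (simp add: integral_unique)
qed

text \<open>The derivative \<open>u'\<close> need not be monotone, but its running infimum
  \<open>v\<close> is nonincreasing and lies between \<open>\<gamma> * u'\<close> and
  \<open>u'\<close>. The condition makes all integrals of \<open>h\<close> from \<open>xl\<close>
  nonnegative, hence also that of \<open>v * h\<close>, which is at most
  \<open>\<gamma> * (u' * g)\<close> pointwise.\<close>

lemma one_plus_sd_if_integral_condition:
  fixes xl xu :: real
  assumes P: "borel_law_on {xl..xu} P" and Q: "borel_law_on {xl..xu} Q" and le: "xl \<le> xu"
    and \<gamma>: "0 \<le> \<gamma>"
    and cond: "\<And>t. xl \<le> t \<Longrightarrow> (LINT z:{xl..t}|lborel. max (dist_fun Q z - dist_fun P z) 0)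
      \<le> \<gamma> * (LINT z:{xl..t}|lborel. max (dist_fun P z - dist_fun Q z) 0)"
  shows "one_plus_sd \<gamma> P Q"
  unfolding one_plus_sd_def
proof (intro allI impI, elim conjE)
  fix u u' :: "real \<Rightarrow> real"
  assume "mono u" and "\<forall>x. (u has_real_derivative u' x) (at x)"
    and "\<forall>x y. x \<le> y \<longrightarrow> 0 \<le> \<gamma> * u' y \<and> \<gamma> * u' y \<le> u' x"
  then have d: "\<And>x. (u has_real_derivative u' x) (at x)"
    and dec: "\<And>x y. x \<le> y \<Longrightarrow> \<gamma> * u' y \<le> u' x" by auto
  have nonneg: "0 \<le> u' x" for x
    using \<open>mono u\<close> d[of x] by (intro mono_on_imp_deriv_nonneg[of UNIV u]) auto
  define g where "g z = dist_fun P z - dist_fun Q z" for z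
  have pq: "prob_space P" "sets P = sets borel" "prob_space Q" "sets Q = sets borel"
    using P Q by (auto simp: borel_law_on_def)
  have ip: "set_integrable lborel {a..b} (\<lambda>z. max (g z) 0)" for a b
    unfolding g_def by (rule set_integrable_dist_fun_diff[OF pq])
  have im: "set_integrable lborel {a..b} (\<lambda>z. max (- g z) 0)" for a b
    using set_integrable_dist_fun_diff[OF pq(3,4,1,2)] by (simp add: g_def)
  have cond': "(LINT z:{xl..t}|lborel. max (- g z) 0) \<le> \<gamma> * (LINT z:{xl..t}|lborel. max (g z) 0)" if "xl \<le> t" for t
    using cond[OF that] by (simp add: g_def)
  note diff = expectation_diff_eq_integral[OF P Q le d nonneg, folded g_def]
  have "0 \<le> (LINT z:{xl..xu}|lborel. u' z * g z)"
  \<comment> \<open>The main argument ends by dividing by \<gamma>. At \<gamma> = 0 the condition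
    instead makes the negative part of \<open>g\<close> vanish almost everywhere.\<close>
  proof (cases "\<gamma> = 0")
    case True
    have "(LINT z:{xl..xu}|lborel. max (- g z) 0) = 0"
      using cond'[OF le] True unfolding set_lebesgue_integral_def
      by (intro antisym Bochner_Integration.integral_nonneg) auto
    then have "AE z in lborel. indicator {xl..xu} z *\<^sub>R max (- g z) 0 = 0"
      using im[of xl xu] unfolding set_lebesgue_integral_def set_integrable_def
      by (subst integral_nonneg_eq_0_iff_AE[symmetric]) auto
    then have "AE z in lborel. 0 \<le> indicator {xl..xu} z *\<^sub>R (u' z * g z)"
      by eventually_elim (auto simp: nonneg max_def split: split_indicator if_splits)
    then show ?thesis
      unfolding set_lebesgue_integral_def by (rule integral_nonneg_AE)
  next
    case False
    with \<gamma> have "\<gamma> > 0" by simp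
    define v where "v z = Inf (u' ` {xl..z})" for z
    define h where "h z = \<gamma> * max (g z) 0 - max (- g z) 0" for z
    have bdd: "bdd_below (u' ` {xl..z})" for z
      using nonneg by (intro bdd_belowI[of _ 0]) auto
    have v_le: "v z \<le> u' z" if "xl \<le> z" for z
      unfolding v_def using that bdd by (intro cInf_lower) auto
    have le_v: "\<gamma> * u' z \<le> v z" if "xl \<le> z" for z
      unfolding v_def using that dec by (intro cInf_greatest) auto
    have v_dec: "v y \<le> v x" if "xl \<le> x" "x \<le> y" for x y
      unfolding v_def using that bdd by (intro cInf_superset_mono) auto
    have v0: "0 \<le> v z" if "xl \<le> z" for z
      using le_v[OF that] nonneg[of z] \<gamma> by (meson mult_nonneg_nonneg order.trans)
    have ih: "set_integrable lborel {xl..t} h" for t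
      unfolding h_def using ip im by (intro set_integral_diff set_integrable_mult_right) auto
    have "0 \<le> integral {xl..t} h" if "t \<in> {xl..xu}" for t
    proof -
      have "integral {xl..t} h = (LINT z:{xl..t}|lborel. h z)"
        using set_borel_integral_eq_integral(2)[OF ih] by simp
      also have "\<dots> = \<gamma> * (LINT z:{xl..t}|lborel. max (g z) 0) - (LINT z:{xl..t}|lborel. max (- g z) 0)"
        unfolding h_def using ip im
        by (subst set_integral_diff(2)) (auto intro!: set_integrable_mult_right)
      also have "\<dots> \<ge> 0" using cond'[of t] that by simp
      finally show ?thesis .
    qed
    note vh = integral_antimono_weight_nonneg[of h xl xu v,
        OF set_borel_integral_eq_integral(1)[OF ih] le v_dec v0[OF le] this]
    have "0 \<le> integral {xl..xu} (\<lambda>z. v z * h z)" by (rule vh(2))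
    also have "\<dots> \<le> integral {xl..xu} (\<lambda>z. \<gamma> * (u' z * g z))"
    proof (rule integral_le[OF vh(1)])
      show "(\<lambda>z. \<gamma> * (u' z * g z)) integrable_on {xl..xu}"
        using set_borel_integral_eq_integral(1)[OF diff(2)] by (rule integrable_on_mult_right)
      fix z assume "z \<in> {xl..xu}"
      then have z: "v z \<le> u' z" "\<gamma> * u' z \<le> v z" using v_le le_v by auto
      have "v z * h z = v z * (\<gamma> * max (g z) 0) - v z * max (- g z) 0"
        by (simp add: h_def algebra_simps)
      \<comment> \<open>The upper bound \<open>v \<le> u'\<close> is used on the positive part of
        \<open>g\<close>, the lower bound \<open>\<gamma> * u' \<le> v\<close> on the negative
        part.\<close>
      also have "\<dots> \<le> u' z * (\<gamma> * max (g z) 0) - (\<gamma> * u' z) * max (- g z) 0"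
        using z \<gamma> by (intro diff_mono mult_right_mono) auto
      also have "\<dots> = \<gamma> * (u' z * g z)"
        by (auto simp: max_def)
      finally show "v z * h z \<le> \<gamma> * (u' z * g z)" .
    qed auto
    also have "\<dots> = \<gamma> * (LINT z:{xl..xu}|lborel. u' z * g z)"
      using set_borel_integral_eq_integral(2)[OF diff(2)] by simp
    finally show ?thesis
      using \<open>\<gamma> > 0\<close> by (simp add: zero_le_mult_iff)
  qed
  then show "(LINT x|P. u x) \<le> (LINT x|Q. u x)"
    using diff(1) by simp
qed

section \<open>From utilities to the integral condition\<close>

definition ramp :: "nat \<Rightarrow> real \<Rightarrow> real \<Rightarrow> real" where
  "ramp k x z = max 0 (min 1 (1 - real k * (x - z)))"

lemma ramp_bounds: "0 \<le> ramp k x z" "ramp k x z \<le> 1"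
  by (auto simp: ramp_def)

text \<open>For \<open>k > 0\<close> the ramp falls linearly from 1 at \<open>z\<close> to 0 at
  \<open>z + 1 / k\<close>. Being 1 at \<open>x = z\<close> for every \<open>k\<close>, it keeps a
  possible atom at \<open>z\<close> in the limit.\<close>

lemma ramp_tendsto: "(\<lambda>k. ramp k x z) \<longlonglongrightarrow> indicator {..z} x"
proof (cases "x \<le> z")
  case True
  then have "ramp k x z = 1" for k
    by (simp add: ramp_def mult_nonneg_nonpos)
  then show ?thesis using True by simp
next
  case False
  then obtain N where N: "1 < real N * (x - z)"
    using reals_Archimedean3[of "x - z"] by auto
  have "ramp k x z = 0" if "k \<ge> N" for k
  proof -
    have "real N * (x - z) \<le> real k * (x - z)"
      using that False by (intro mult_right_mono) auto
    with N show ?thesis by (simp add: ramp_def)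
  qed
  then show ?thesis
    using False by (intro tendsto_eventually) (auto simp: eventually_sequentially)
qed

lemma ramp_lipschitz: "\<bar>ramp k x z - ramp k x' z'\<bar> \<le> real k * (\<bar>x - x'\<bar> + \<bar>z - z'\<bar>)"
proof -
  have "\<bar>ramp k x z - ramp k x' z'\<bar> \<le> \<bar>real k * (x - z) - real k * (x' - z')\<bar>"
    unfolding ramp_def by linarith
  also have "\<dots> = real k * \<bar>(x - x') - (z - z')\<bar>"
  proof -
    have "real k * (x - z) - real k * (x' - z') = real k * ((x - x') - (z - z'))"
      by (simp add: algebra_simps)
    then show ?thesis by (simp only: abs_mult abs_of_nat)
  qed
  also have "\<dots> \<le> real k * (\<bar>x - x'\<bar> + \<bar>z - z'\<bar>)"
    by (intro mult_left_mono) auto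
  finally show ?thesis .
qed

lemma ramp_antimono: "x \<le> x' \<Longrightarrow> ramp k x' z \<le> ramp k x z"
  unfolding ramp_def by (intro max.mono min.mono diff_left_mono mult_left_mono) auto

lemma continuous_ramp: "continuous_on A (\<lambda>x. ramp k x z)"
  unfolding ramp_def by (intro continuous_intros)

lemma measurable_ramp[measurable]: "(\<lambda>x. ramp k x z) \<in> borel_measurable borel"
  by (rule borel_measurable_continuous_onI[OF continuous_ramp])

context real_distribution
begin

text \<open>A continuous stand-in for a distribution function that may jump: the test derivatives
  built from it are continuous and so have antiderivatives.\<close>

definition smooth_cdf :: "nat \<Rightarrow> real \<Rightarrow> real" where
  "smooth_cdf k z = (LINT x|M. ramp k x z)"

lemma integrable_ramp: "integrable M (\<lambda>x. ramp k x z)"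
  by (rule integrable_const_bound[of _ 1]) (auto simp: ramp_bounds)

lemma smooth_cdf_tendsto: "(\<lambda>k. smooth_cdf k z) \<longlonglongrightarrow> dist_fun M z"
proof -
  have "(\<lambda>k. LINT x|M. ramp k x z) \<longlonglongrightarrow> (LINT x|M. indicator {..z} x)"
    by (rule integral_dominated_convergence[of _ _ _ "\<lambda>_. 1"]) (auto simp: ramp_tendsto ramp_bounds)
  then show ?thesis by (simp add: smooth_cdf_def dist_fun_def)
qed

lemma continuous_smooth_cdf: "continuous_on UNIV (smooth_cdf k)"
proof (rule lipschitz_on_continuous_on)
  show "(real k)-lipschitz_on UNIV (smooth_cdf k)"
  proof (rule lipschitz_onI)
    fix y z
    have "dist (smooth_cdf k y) (smooth_cdf k z) = \<bar>LINT x|M. ramp k x y - ramp k x z\<bar>"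
      by (simp add: smooth_cdf_def dist_real_def integrable_ramp)
    also have "\<dots> \<le> (LINT x|M. \<bar>ramp k x y - ramp k x z\<bar>)"
      by (rule integral_abs_bound)
    also have "\<dots> \<le> (LINT x|M. real k * \<bar>y - z\<bar>)"
      using ramp_lipschitz[of k _ y _ z]
      by (intro integral_mono) (auto intro!: integrable_ramp simp: le_fun_def, metis abs_zero add_0 diff_self)
    finally show "dist (smooth_cdf k y) (smooth_cdf k z) \<le> real k * dist y z"
      using prob_space by (simp add: dist_real_def)
  qed simp
qed

end

text \<open>The test derivative is \<open>u' k\<close>: the factor \<open>w k\<close> tends to
  \<gamma> where \<open>g > 0\<close> and to 1 where \<open>g < 0\<close>, and the ramp cuts off
  beyond \<open>t\<close>. Dominated convergence turns the utility inequalities into the condition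
  at \<open>t\<close>.\<close>

lemma integral_condition_if_one_plus_sd:
  fixes xl xu :: real
  assumes P: "borel_law_on {xl..xu} P" and Q: "borel_law_on {xl..xu} Q" and le: "xl \<le> xu"
    and \<gamma>: "0 \<le> \<gamma>" "\<gamma> \<le> 1" and sd: "one_plus_sd \<gamma> P Q"
  shows "(LINT z:{xl..t}|lborel. max (dist_fun Q z - dist_fun P z) 0)
      \<le> \<gamma> * (LINT z:{xl..t}|lborel. max (dist_fun P z - dist_fun Q z) 0)"
proof -
  interpret p1: real_distribution P using P by (rule borel_law_on_real_distribution)
  interpret p2: real_distribution Q using Q by (rule borel_law_on_real_distribution)
  have pq: "prob_space P" "sets P = sets borel" "prob_space Q" "sets Q = sets borel"
    using P Q by (auto simp: borel_law_on_def)
  have [measurable]: "dist_fun P \<in> borel_measurable borel" "dist_fun Q \<in> borel_measurable borel"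
    using pq by (simp_all add: measurable_dist_fun)
  define g where "g z = dist_fun P z - dist_fun Q z" for z
  define gk where "gk k z = p1.smooth_cdf k z - p2.smooth_cdf k z" for k z
  \<comment> \<open>Clamping \<open>real k * gk k z\<close> to the unit interval approximates the
    indicator of \<open>g > 0\<close> wherever \<open>g\<close> is nonzero, while \<open>w\<close>
    stays between \<gamma> and 1.\<close>
  define w where "w k z = 1 - (1 - \<gamma>) * max 0 (min 1 (real k * gk k z))" for k z
  define h where "h z = \<gamma> * max (g z) 0 - max (- g z) 0" for z
  have [measurable]: "g \<in> borel_measurable borel" unfolding g_def[abs_def] by measurable
  have g1: "\<bar>g z\<bar> \<le> 1" for z
    using p1.prob_le_1[of "{..z}"] p2.prob_le_1[of "{..z}"] measure_nonneg[of P "{..z}"] measure_nonneg[of Q "{..z}"]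
    unfolding g_def dist_fun_def by linarith
  have w_bounds: "\<gamma> \<le> w k z" "w k z \<le> 1" for k z
  proof -
    have "(1 - \<gamma>) * max 0 (min 1 (real k * gk k z)) \<le> (1 - \<gamma>) * 1"
      using \<gamma> by (intro mult_left_mono) auto
    then show "\<gamma> \<le> w k z" by (simp add: w_def)
    show "w k z \<le> 1" using \<gamma> by (simp add: w_def)
  qed
  have cont_w: "continuous_on UNIV (w k)" for k
    unfolding w_def[abs_def] gk_def
    by (intro continuous_intros p1.continuous_smooth_cdf p2.continuous_smooth_cdf)
  define u' where "u' k z = w k z * ramp k z t" for k z
  have cont: "continuous_on UNIV (u' k)" for k
    unfolding u'_def by (intro continuous_intros cont_w continuous_ramp)
  then have [measurable]: "u' k \<in> borel_measurable borel" for k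
    by (rule borel_measurable_continuous_onI)
  have u'0: "0 \<le> u' k z" and u'1: "u' k z \<le> 1" for k z
    using w_bounds[of k z] ramp_bounds[of k z t] \<gamma> by (auto simp: u'_def intro!: mult_le_one)
  have pos: "0 \<le> (LINT z:{xl..xu}|lborel. u' k z * g z)" for k
  proof -
    have "isCont (u' k) x" for x using cont[of k] by (simp add: continuous_on_eq_continuous_at)
    then obtain u where u: "\<And>x. (u has_real_derivative u' k x) (at x)"
      using einterval_antiderivative[of "-\<infinity>" "\<infinity>" "u' k"]
      by (auto simp: has_real_derivative_iff_has_vector_derivative)
    have "mono u"
    proof (rule monoI)
      fix x y :: real assume "x \<le> y"
      then show "u x \<le> u y"
        by (rule DERIV_nonneg_imp_nondecreasing) (use u u'0 in blast)
    qed
    \<comment> \<open>Only \<open>w \<le> 1\<close> at \<open>y\<close> and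
      \<open>\<gamma> \<le> w\<close> at \<open>x\<close> enter, besides the ramp being
      nonincreasing.\<close>
    moreover have "\<gamma> * u' k y \<le> u' k x" if "x \<le> y" for x y
    proof -
      have "\<gamma> * u' k y \<le> \<gamma> * ramp k y t"
        unfolding u'_def using w_bounds[of k y] ramp_bounds[of k y t] \<gamma>
        by (intro mult_left_mono mult_left_le_one_le) linarith+
      also have "\<dots> \<le> w k x * ramp k x t"
        using w_bounds[of k x] ramp_bounds[of k y t] ramp_antimono[OF that] \<gamma>
        by (intro mult_mono) auto
      finally show ?thesis by (simp add: u'_def)
    qed
    moreover have "0 \<le> \<gamma> * u' k y" for y using u'0 \<gamma> by simp
    ultimately have "(LINT x|P. u x) \<le> (LINT x|Q. u x)"
      using sd u unfolding one_plus_sd_def by blast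
    then show ?thesis
      using expectation_diff_eq_integral(1)[OF P Q le u u'0] by (simp add: g_def)
  qed
  have gk_lim: "(\<lambda>k. gk k z) \<longlonglongrightarrow> g z" for z
    unfolding gk_def g_def by (intro tendsto_diff p1.smooth_cdf_tendsto p2.smooth_cdf_tendsto)
  have w_lim: "(\<lambda>k. w k z * g z) \<longlonglongrightarrow> h z" for z
  proof -
    \<comment> \<open>Where \<open>g\<close> vanishes, \<open>w k\<close> itself may fail to
      converge, but the product is constantly zero; elsewhere the clamp eventually
      saturates.\<close>
    consider "g z = 0" | "g z > 0" | "g z < 0" by linarith
    then show ?thesis
    proof cases
      case 1
      then show ?thesis by (simp add: h_def)
    next
      case 2
      have "filterlim (\<lambda>k. gk k z * real k) at_top sequentially"
        by (rule filterlim_tendsto_pos_mult_at_top[OF gk_lim 2 filterlim_real_sequentially])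
      then have "eventually (\<lambda>k. 1 \<le> gk k z * real k) sequentially"
        by (simp add: filterlim_at_top)
      then have "eventually (\<lambda>k. w k z * g z = h z) sequentially"
        by eventually_elim (use 2 in \<open>simp add: w_def h_def mult.commute\<close>)
      then show ?thesis by (rule tendsto_eventually)
    next
      case 3
      have "eventually (\<lambda>k. gk k z < 0) sequentially"
        using order_tendstoD(2)[OF gk_lim 3] .
      then have "eventually (\<lambda>k. w k z * g z = h z) sequentially"
      proof eventually_elim
        case (elim k)
        then have "real k * gk k z \<le> 0" by (simp add: mult_nonneg_nonpos)
        then show ?case using 3 by (simp add: w_def h_def)
      qed
      then show ?thesis by (rule tendsto_eventually)
    qed
  qed
  have lim: "(\<lambda>k. LINT z:{xl..xu}|lborel. u' k z * g z) \<longlonglongrightarrow> (LINT z:{xl..xu}|lborel. indicator {..t} z * h z)"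
    unfolding set_lebesgue_integral_def
  proof (rule integral_dominated_convergence[of _ _ _ "indicator {xl..xu}"])
    show "integrable lborel (indicator {xl..xu} :: real \<Rightarrow> real)"
      by (rule integrable_real_indicator) (auto simp: emeasure_lborel_Icc_eq)
    show "AE z in lborel. (\<lambda>k. indicator {xl..xu} z *\<^sub>R (u' k z * g z)) \<longlonglongrightarrow> indicator {xl..xu} z *\<^sub>R (indicator {..t} z * h z)"
    proof (rule AE_I2, rule tendsto_scaleR[OF tendsto_const])
      fix z
      have "(\<lambda>k. ramp k z t * (w k z * g z)) \<longlonglongrightarrow> indicator {..t} z * h z"
        by (intro tendsto_mult ramp_tendsto w_lim)
      then show "(\<lambda>k. u' k z * g z) \<longlonglongrightarrow> indicator {..t} z * h z"
        by (simp add: u'_def mult_ac)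
    qed
    show "AE z in lborel. norm (indicator {xl..xu} z *\<^sub>R (u' k z * g z)) \<le> indicator {xl..xu} z" for k
      using u'0 u'1 g1 by (auto simp: abs_mult intro!: mult_le_one split: split_indicator)
  qed (auto simp: h_def)
  have "0 \<le> (LINT z:{xl..xu}|lborel. indicator {..t} z * h z)"
    by (rule LIMSEQ_le_const[OF lim]) (use pos in auto)
  also have "\<dots> = (LINT z:{xl..t}|lborel. h z)"
    unfolding set_lebesgue_integral_def
  proof (intro Bochner_Integration.integral_cong refl)
    fix z
    \<comment> \<open>Above \<open>xu\<close> both distribution functions equal 1, so the integral
      over the box and the one up to \<open>t\<close> agree even when \<open>t\<close> exceeds
      \<open>xu\<close>.\<close>
    have "h z = 0" if "xu < z"
    proof -
      have "AE x in P. x \<in> {..z}" "AE x in Q. x \<in> {..z}"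
        by (rule eventually_mono[OF borel_law_on_AE[OF P]], use that in simp)
           (rule eventually_mono[OF borel_law_on_AE[OF Q]], use that in simp)
      then have "dist_fun P z = 1" "dist_fun Q z = 1"
        unfolding dist_fun_def by (auto intro!: p1.prob_eq_1[THEN iffD2] p2.prob_eq_1[THEN iffD2])
      then show ?thesis by (simp add: h_def g_def)
    qed
    then show "indicator {xl..xu} z *\<^sub>R (indicator {..t} z * h z) = indicator {xl..t} z *\<^sub>R h z"
      by (auto split: split_indicator)
  qed
  also have "\<dots> = \<gamma> * (LINT z:{xl..t}|lborel. max (g z) 0) - (LINT z:{xl..t}|lborel. max (- g z) 0)"
    unfolding h_def
    using set_integrable_dist_fun_diff[OF pq, of xl t] set_integrable_dist_fun_diff[OF pq(3,4,1,2), of xl t]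
    by (subst set_integral_diff(2)) (auto intro!: set_integrable_mult_right simp: g_def)
  finally show ?thesis by (simp add: g_def)
qed

theorem lower_orthant_csd_real_iff:
  fixes xl xu :: real
  assumes "xl \<le> xu" "borel_law_on {xl..xu} P" "borel_law_on {xl..xu} Q" "0 \<le> \<gamma>" "\<gamma> \<le> 1"
  shows "lower_orthant_csd xl xu \<gamma> P Q \<longleftrightarrow> one_plus_sd \<gamma> P Q"
  unfolding lower_orthant_csd_def csd_lower_orthant_real_iff[OF assms(2-5)]
  using one_plus_sd_if_integral_condition[OF assms(2,3,1,4)]
    integral_condition_if_one_plus_sd[OF assms(2,3,1,4,5)] by blast

lemma nondegenerate_rect_le:
  fixes xl xu :: "'a::ordered_euclidean_space"
  shows "nondegenerate_rect xl xu \<Longrightarrow> xl \<le> xu"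
  by (auto simp: nondegenerate_rect_def eucl_le[where 'a='a] intro: less_imp_le)

theorem corollary2p13:
  shows "(\<forall>(xl :: 'a::ordered_euclidean_space) xu P Q.
            nondegenerate_rect xl xu \<and> borel_law_on {xl..xu} P \<and> borel_law_on {xl..xu} Q \<longrightarrow>
              (lower_orthant_csd xl xu 0 P Q \<longleftrightarrow> fosd P Q) \<and>
              (lower_orthant_csd xl xu 1 P Q \<longleftrightarrow> lower_orthant_sd2 P Q))
       \<and> (\<forall>(xl :: real) xu P Q.
            nondegenerate_rect xl xu \<and> borel_law_on {xl..xu} P \<and> borel_law_on {xl..xu} Q \<longrightarrow>
              (\<forall>\<gamma>\<in>{0..1}. lower_orthant_csd xl xu \<gamma> P Q \<longleftrightarrow> one_plus_sd \<gamma> P Q))"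
proof (intro conjI allI impI ballI; elim conjE)
  fix xl xu :: 'a and P Q
  assume "nondegenerate_rect xl xu" "borel_law_on {xl..xu} P" "borel_law_on {xl..xu} Q"
  then show "lower_orthant_csd xl xu 0 P Q \<longleftrightarrow> fosd P Q"
    by (intro lower_orthant_csd_zero_iff nondegenerate_rect_le)
next
  fix xl xu :: 'a and P Q
  assume "borel_law_on {xl..xu} P" "borel_law_on {xl..xu} Q"
  then show "lower_orthant_csd xl xu 1 P Q \<longleftrightarrow> lower_orthant_sd2 P Q"
    by (rule lower_orthant_csd_one_iff)
next
  fix xl xu :: real and P Q and \<gamma> :: real
  assume "nondegenerate_rect xl xu" "borel_law_on {xl..xu} P" "borel_law_on {xl..xu} Q" "\<gamma> \<in> {0..1}"
  then show "lower_orthant_csd xl xu \<gamma> P Q \<longleftrightarrow> one_plus_sd \<gamma> P Q"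
    using nondegenerate_rect_le[of xl xu] by (intro lower_orthant_csd_real_iff) auto
qed

end
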